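(* Let $n\ge 2$. For each value $d\in(n,n+1)$ there exists an uncountable collection of compact topological hypersurfaces $\mathcal{S}^{n+1}_{\alpha,\beta}\subset\mathbb{R}^{n+1}$, indexed by suitable values of parameters $\alpha\ge 1$ and $\beta\ge n$, each of which is the boundary of a Jordan domain in $\mathbb{R}^{n+1}$, such that every member of the collection satisfies $$\overline{\dim}_{M}(\mathcal{S}^{n+1}_{\alpha,\beta})=d\qquad\text{and}\qquad \mathfrak{m}(\mathcal{S}^{n+1}_{\alpha,\beta})>(n+1)-\overline{\dim}_{M}(\mathcal{S}^{n+1}_{\alpha,\beta}).$$
   Context: Domains: a compact topological hypersurface $\mathcal{S}\subset\mathbb{R}^{n+1}$ is the boundary of a Jordan domain $\Omega^+$ if $\Omega^+$ and $\Omega^-$ are the bounded and the unbounded component of $\mathbb{R}^{n+1}\setminus\mathcal{S}=\Omega^+\cup\Omega^-$, with $\partial\Omega^+=\mathcal{S}$. Upper Minkowski dimension: for a non-empty bounded set $\mathbf{E}\subset\mathbb{R}^{n+1}$ let $N_\delta(\mathbf{E})$ be the smallest number of sets of diameter at most $\delta$ covering $\mathbf{E}$; then $$\overline{\dim}_M\mathbf{E}=\limsup_{\delta\to0}\frac{\log N_\delta(\mathbf{E})}{-\log\delta}.$$ Marcinkiewicz exponent: for a bounded set $D\subset\mathbb{R}^{n+1}$ not touching $\mathcal{S}$ put $I_p(D)=\int_D\frac{dV(x)}{\mathrm{dist}^p(x,\mathcal{S})}$, where $dV$ is the volume element. Let $\Omega^*=\Omega^-\cap\{x:|x|<r\}$,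 where $r$ is such that $\mathcal{S}\subset\{|x|<r\}$ (the choice of $r$ is immaterial below). Then $\mathfrak{m}^+(\mathcal{S})=\sup\{p:I_p(\Omega^+)<\infty\}$, $\mathfrak{m}^-(\mathcal{S})=\sup\{p:I_p(\Omega^* )<\infty\}$ and $\mathfrak{m}(\mathcal{S})=\max\{\mathfrak{m}^+(\mathcal{S}),\mathfrak{m}^-(\mathcal{S})\}$. The symbols $\mathcal{S}^{n+1}_{\alpha,\beta}$ are only names for the members of the collection whose existence is asserted. *)

theory Defs
  imports "HOL-Analysis.Analysis"
begin

text \<open>The Hausdorff property and second countability of a manifold are inherited from the ambient
  space. The library type-free model \<^const>\<open>Euclidean_space\<close> is used so that the dimension of
  the charts is a natural number.\<close>

definition compact_topological_hypersurface :: "nat \<Rightarrow> 'a::euclidean_space set \<Rightarrow> bool" where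
  "compact_topological_hypersurface n S \<longleftrightarrow>
     DIM('a) = n + 1 \<and> compact S \<and>
     (\<forall>x\<in>S. \<exists>U V. openin (top_of_set S) U \<and> x \<in> U \<and> openin (Euclidean_space n) V \<and>
        top_of_set U homeomorphic_space subtopology (Euclidean_space n) V)"

text \<open>\<^term>\<open>inside S\<close> and \<^term>\<open>outside S\<close> are the unions of the bounded, respectively unbounded,
  components of the complement of \<open>S\<close>; the first conjunct therefore says that there is exactly
  one component of each kind.\<close>

definition boundary_of_Jordan_domain :: "'a::euclidean_space set \<Rightarrow> bool" where
  "boundary_of_Jordan_domain S \<longleftrightarrow>
     components (- S) = {inside S, outside S} \<and> frontier (inside S) = S"

text \<open>Boundedness of the covering sets is required explicitly because \<^const>\<open>diameter\<close> has an
  unspecified value on unbounded sets.\<close>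

definition covering_number :: "real \<Rightarrow> 'a::metric_space set \<Rightarrow> nat" where
  "covering_number \<delta> E =
     (LEAST k. \<exists>F. finite F \<and> card F = k \<and>
        (\<forall>A\<in>F. bounded A \<and> diameter A \<le> \<delta>) \<and> E \<subseteq> \<Union>F)"

definition upper_Minkowski_dim :: "'a::metric_space set \<Rightarrow> ereal" where
  "upper_Minkowski_dim E =
     Limsup (at_right 0) (\<lambda>\<delta>::real. ereal (ln (real (covering_number \<delta> E)) / (- ln \<delta>)))"

definition Marcinkiewicz_integral ::
    "'a::euclidean_space set \<Rightarrow> real \<Rightarrow> 'a set \<Rightarrow> ennreal" where
  "Marcinkiewicz_integral S p D = (\<integral>\<^sup>+x\<in>D. ennreal (1 / infdist x S powr p) \<partial>lborel)"

definition Marcinkiewicz_exponent_plus :: "'a::euclidean_space set \<Rightarrow> ereal" where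
  "Marcinkiewicz_exponent_plus S =
     Sup {ereal p |p. Marcinkiewicz_integral S p (inside S) < \<infinity>}"

text \<open>The truncation radius \<open>r\<close> is kept as a parameter; the value is the same for all \<open>r\<close> with
  \<^prop>\<open>S \<subseteq> ball 0 r\<close>.\<close>

definition Marcinkiewicz_exponent_minus :: "real \<Rightarrow> 'a::euclidean_space set \<Rightarrow> ereal" where
  "Marcinkiewicz_exponent_minus r S =
     Sup {ereal p |p. Marcinkiewicz_integral S p (outside S \<inter> ball 0 r) < \<infinity>}"

definition Marcinkiewicz_exponent :: "real \<Rightarrow> 'a::euclidean_space set \<Rightarrow> ereal" where
  "Marcinkiewicz_exponent r S =
     max (Marcinkiewicz_exponent_plus S) (Marcinkiewicz_exponent_minus r S)"

end

theory Submission
  imports Defs "HOL-Homology.Invariance_of_Domain"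
begin

text \<open>Take the cube and stretch it vertically by the factor \<open>1 + g(x\<^sub>1)\<close>, where \<open>g\<close> is a
  continuous function of one coordinate consisting of thin tents: the \<open>k\<close>-th tent has height
  \<open>k\<^sup>-\<^sup>a\<close> and sits at the left end of an interval of length about \<open>k\<^sup>-\<^sup>\<alpha>\<close>, and these intervals tile
  \<open>(0, 1]\<close>. The stretching is a homeomorphism of the whole space, so the image \<open>S\<close> of the boundary
  of the cube is a hypersurface bounding a Jordan domain.

  At scale \<open>k\<^sup>-\<^sup>\<alpha>\<close> the spikes beyond the \<open>k\<close>-th one fill a box of width \<open>k\<^sup>1\<^sup>-\<^sup>\<alpha>\<close> and height \<open>k\<^sup>-\<^sup>a\<close>,
  while the earlier ones have total length about \<open>k\<^sup>1\<^sup>-\<^sup>a\<close>; both counts give the dimension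
  \<open>d = n + (1 - a) / \<alpha>\<close>. The exponents satisfying this for a given \<open>d\<close> form a curve, and \<open>S\<close>
  determines \<open>\<alpha>\<close> as it determines the location of the highest spike.

  The tents are so narrow (their widths decay geometrically) that the spikes contribute little to
  the integral over the interior. The interior is a union of convex sets, namely the cube and the
  spikes, and the integral over a convex set of volume \<open>V\<close> containing a ball of radius \<open>r\<close> is
  \<open>O(V r\<^sup>-\<^sup>p)\<close> for every \<open>p < 1\<close>. Hence the exponent of \<open>S\<close> is at least \<open>1\<close>, which exceeds
  \<open>n + 1 - d\<close>.\<close>

section \<open>Coverings and the upper Minkowski dimension\<close>

text \<open>The bound \<open>c\<close> is real and need not be attained, so that counts can be
  added, weakened and compared with powers of \<open>\<delta>\<close> without computing a
  minimum.\<close>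

definition coverable :: "real \<Rightarrow> 'a::metric_space set \<Rightarrow> real \<Rightarrow> bool" where
  "coverable \<delta> E c \<longleftrightarrow>
     (\<exists>F. finite F \<and> real (card F) \<le> c \<and> (\<forall>A\<in>F. bounded A \<and> diameter A \<le> \<delta>) \<and> E \<subseteq> \<Union>F)"

lemma coverable_mono:
  assumes "coverable \<delta> E c" "E' \<subseteq> E" "c \<le> c'" "\<delta> \<le> \<delta>'"
  shows "coverable \<delta>' E' c'"
proof -
  obtain F where F: "finite F" "real (card F) \<le> c" "\<forall>A\<in>F. bounded A \<and> diameter A \<le> \<delta>" "E \<subseteq> \<Union>F"
    using assms(1) unfolding coverable_def by blast
  have "\<forall>A\<in>F. bounded A \<and> diameter A \<le> \<delta>'" using F(3) assms(4) by force
  moreover have "real (card F) \<le> c'" using F(2) assms(3) by linarith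
  moreover have "E' \<subseteq> \<Union>F" using F(4) assms(2) by blast
  ultimately show ?thesis unfolding coverable_def using F(1) by blast
qed

lemma coverable_empty: "coverable \<delta> {} 0"
  unfolding coverable_def by (rule exI[of _ "{}"]) auto

lemma coverable_Un:
  assumes "coverable \<delta> E c" "coverable \<delta> E' c'"
  shows "coverable \<delta> (E \<union> E') (c + c')"
proof -
  obtain F where F: "finite F" "real (card F) \<le> c" "\<forall>A\<in>F. bounded A \<and> diameter A \<le> \<delta>" "E \<subseteq> \<Union>F"
    using assms(1) unfolding coverable_def by blast
  obtain F' where F': "finite F'" "real (card F') \<le> c'" "\<forall>A\<in>F'. bounded A \<and> diameter A \<le> \<delta>" "E' \<subseteq> \<Union>F'"
    using assms(2) unfolding coverable_def by blast
  have "real (card (F \<union> F')) \<le> c + c'"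
    using card_Un_le[of F F'] F(2) F'(2) by linarith
  moreover have "finite (F \<union> F')" "\<forall>A\<in>F \<union> F'. bounded A \<and> diameter A \<le> \<delta>" "E \<union> E' \<subseteq> \<Union>(F \<union> F')"
    using F F' by auto
  ultimately show ?thesis unfolding coverable_def by blast
qed

lemma coverable_UN:
  assumes "finite I" "\<And>i. i \<in> I \<Longrightarrow> coverable \<delta> (E i) (c i)"
  shows "coverable \<delta> (\<Union>i\<in>I. E i) (\<Sum>i\<in>I. c i)"
  using assms
proof (induction I rule: finite_induct)
  case empty
  then show ?case by (simp add: coverable_empty)
next
  case (insert x I)
  then show ?case using coverable_Un[of \<delta> "E x" "c x"] by simp
qed

lemma coverable_lipschitz_image:
  assumes "coverable \<delta> E c" "L-lipschitz_on E f"
  shows "coverable (L * \<delta>) (f ` E) c"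
proof -
  obtain F where F: "finite F" "real (card F) \<le> c" "\<forall>A\<in>F. bounded A \<and> diameter A \<le> \<delta>" "E \<subseteq> \<Union>F"
    using assms(1) unfolding coverable_def by blast
  have L0: "0 \<le> L" using assms(2) lipschitz_on_nonneg by blast
  show ?thesis
    unfolding coverable_def
  \<comment> \<open>Members of the cover that miss \<open>E\<close> are dropped, so every image is
    non-empty and its diameter is a genuine supremum.\<close>
  proof (intro exI[of _ "(\<lambda>A. f ` (A \<inter> E)) ` (F - {A\<in>F. A \<inter> E = {}})"] conjI ballI)
    show "finite ((\<lambda>A. f ` (A \<inter> E)) ` (F - {A\<in>F. A \<inter> E = {}}))" using F(1) by simp
    have "card ((\<lambda>A. f ` (A \<inter> E)) ` (F - {A\<in>F. A \<inter> E = {}})) \<le> card F"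
      by (rule order_trans[OF card_image_le card_mono]) (use F(1) in auto)
    then show "real (card ((\<lambda>A. f ` (A \<inter> E)) ` (F - {A\<in>F. A \<inter> E = {}}))) \<le> c" using F(2) by linarith
    show "f ` E \<subseteq> \<Union>((\<lambda>A. f ` (A \<inter> E)) ` (F - {A\<in>F. A \<inter> E = {}}))" using F(4) by auto
    fix B assume "B \<in> (\<lambda>A. f ` (A \<inter> E)) ` (F - {A\<in>F. A \<inter> E = {}})"
    then obtain A where A: "A \<in> F" "A \<inter> E \<noteq> {}" "B = f ` (A \<inter> E)" by blast
    have *: "dist x y \<le> L * \<delta>" if xy: "x \<in> B" "y \<in> B" for x y
    proof -
      obtain u v where uv: "u \<in> A \<inter> E" "v \<in> A \<inter> E" "x = f u" "y = f v" using xy unfolding A(3) by blast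
      have "dist u v \<le> diameter A"
        using diameter_bounded_bound[of A u v] uv F(3) A(1) by blast
      then have "dist u v \<le> \<delta>" using F(3) A(1) by force
      moreover have "dist x y \<le> L * dist u v"
        using assms(2) uv by (auto simp: lipschitz_on_def)
      ultimately show ?thesis using L0 mult_left_mono by fastforce
    qed
    have "B \<noteq> {}" using A by blast
    then obtain x0 where "x0 \<in> B" by blast
    then show "bounded B" unfolding bounded_def using * by blast
    show "diameter B \<le> L * \<delta>" using \<open>B \<noteq> {}\<close> * by (auto simp: diameter_def intro!: cSUP_least)
  qed
qed

lemma coverable_imp_covering_number_le:
  assumes "coverable \<delta> E c"
  shows "real (covering_number \<delta> E) \<le> c"
proof -
  obtain F where F: "finite F" "real (card F) \<le> c" "\<forall>A\<in>F. bounded A \<and> diameter A \<le> \<delta>" "E \<subseteq> \<Union>F"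
    using assms(1) unfolding coverable_def by blast
  have "covering_number \<delta> E \<le> card F"
    unfolding covering_number_def by (rule Least_le) (use F in blast)
  then show ?thesis using F(2) by linarith
qed

text \<open>A \<open>LEAST\<close> is attained only when some finite cover exists; the hypothesis
  supplies one.\<close>

lemma coverable_covering_number:
  assumes "coverable \<delta> E c"
  shows "coverable \<delta> E (real (covering_number \<delta> E))"
proof -
  obtain F where F: "finite F" "real (card F) \<le> c" "\<forall>A\<in>F. bounded A \<and> diameter A \<le> \<delta>" "E \<subseteq> \<Union>F"
    using assms(1) unfolding coverable_def by blast
  have "\<exists>F. finite F \<and> card F = covering_number \<delta> E \<and> (\<forall>A\<in>F. bounded A \<and> diameter A \<le> \<delta>) \<and> E \<subseteq> \<Union>F"
    unfolding covering_number_def by (rule LeastI_ex) (use F in blast)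
  then show ?thesis unfolding coverable_def by (metis order_refl)
qed

text \<open>A grid of cubes with edge \<open>\<delta> / CARD('m)\<close> is used: the norm is at
  most the sum of the absolute coordinates, so each cube has diameter at most
  \<open>\<delta>\<close>.\<close>

lemma coverable_cbox:
  fixes a b :: "real ^ 'm"
  assumes d: "\<delta> > 0" and ab: "\<And>i. a $ i \<le> b $ i"
  shows "coverable \<delta> (cbox a b) (\<Prod>i\<in>UNIV. CARD('m) * (b $ i - a $ i) / \<delta> + 1)"
proof -
  define \<eta> where "\<eta> = \<delta> / CARD('m)"
  have \<eta>: "\<eta> > 0" "CARD('m) * \<eta> = \<delta>" using d by (auto simp: \<eta>_def)
  define C where "C = (\<lambda>j::'m \<Rightarrow> nat. {x::real^'m. \<forall>i. a $ i + j i * \<eta> \<le> x $ i \<and> x $ i \<le> a $ i + (real (j i) + 1) * \<eta>})"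
  \<comment> \<open>The last cell index in direction \<open>i\<close>. Indices start at
    \<open>0\<close>, so there are \<open>M i + 1\<close> cells, which produces the summand 1 in
    each factor.\<close>
  define M where "M = (\<lambda>i. nat \<lfloor>(b $ i - a $ i) / \<eta>\<rfloor>)"
  define J where "J = PiE UNIV (\<lambda>i::'m. {..M i})"
  have diam: "dist x y \<le> \<delta>" if "x \<in> C j" "y \<in> C j" for x y j
  proof -
    have "norm (x - y) \<le> (\<Sum>i\<in>UNIV. \<bar>(x - y) $ i\<bar>)" by (rule norm_le_l1_cart)
    also have "\<dots> \<le> (\<Sum>i\<in>(UNIV::'m set). \<eta>)"
    proof (rule sum_mono)
      fix i
      have "a $ i + j i * \<eta> \<le> x $ i" "x $ i \<le> a $ i + (real (j i) + 1) * \<eta>"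
        "a $ i + j i * \<eta> \<le> y $ i" "y $ i \<le> a $ i + (real (j i) + 1) * \<eta>"
        using that unfolding C_def mem_Collect_eq by metis+
      then show "\<bar>(x - y) $ i\<bar> \<le> \<eta>"
        unfolding vector_minus_component distrib_right by linarith
    qed
    also have "\<dots> = \<delta>" using \<eta> by simp
    finally show ?thesis by (simp add: dist_norm)
  qed
  have ne: "(\<chi> i. a $ i + j i * \<eta>) \<in> C j" for j
    using \<eta> by (simp add: C_def algebra_simps)
  show ?thesis
    unfolding coverable_def
  proof (intro exI[of _ "C ` J"] conjI ballI)
    show "finite (C ` J)" by (simp add: J_def finite_PiE)
    have "card (C ` J) \<le> card J" by (rule card_image_le) (simp add: J_def finite_PiE)
    also have "card J = (\<Prod>i\<in>UNIV. M i + 1)" by (simp add: J_def card_PiE)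
    finally have "real (card (C ` J)) \<le> real (\<Prod>i\<in>UNIV. M i + 1)" by (rule of_nat_mono)
    also have "\<dots> = (\<Prod>i\<in>UNIV. real (M i) + 1)" by (simp add: add.commute)
    also have "\<dots> \<le> (\<Prod>i\<in>UNIV. CARD('m) * (b $ i - a $ i) / \<delta> + 1)"
    proof (rule prod_mono, safe)
      fix i
      have "real (M i) \<le> (b $ i - a $ i) / \<eta>" unfolding M_def using ab[of i] \<eta> by simp
      also have "\<dots> = CARD('m) * (b $ i - a $ i) / \<delta>" by (simp add: \<eta>_def)
      finally show "real (M i) + 1 \<le> CARD('m) * (b $ i - a $ i) / \<delta> + 1" by simp
    qed simp
    finally show "real (card (C ` J)) \<le> (\<Prod>i\<in>UNIV. CARD('m) * (b $ i - a $ i) / \<delta> + 1)" .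
    show "cbox a b \<subseteq> \<Union>(C ` J)"
    proof
      fix x assume x: "x \<in> cbox a b"
      define j where "j = (\<lambda>i. nat \<lfloor>(x $ i - a $ i) / \<eta>\<rfloor>)"
      have xi: "a $ i \<le> x $ i" "x $ i \<le> b $ i" for i using x by (auto simp: mem_box_cart)
      have "j \<in> J" unfolding J_def j_def M_def
        using xi \<eta> by (auto intro!: nat_mono floor_mono divide_right_mono)
      moreover have "x \<in> C j"
        unfolding C_def
      proof (safe)
        fix i
        have "real (j i) = of_int \<lfloor>(x $ i - a $ i) / \<eta>\<rfloor>" unfolding j_def using xi \<eta> by simp
        then have "real (j i) \<le> (x $ i - a $ i) / \<eta>" "(x $ i - a $ i) / \<eta> \<le> real (j i) + 1"
          by linarith+
        then show "a $ i + j i * \<eta> \<le> x $ i" "x $ i \<le> a $ i + (real (j i) + 1) * \<eta>"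
          using \<eta> by (simp_all add: field_simps)
      qed
      ultimately show "x \<in> \<Union>(C ` J)" by blast
    qed
    fix B assume "B \<in> C ` J"
    then obtain j where j: "B = C j" by blast
    show "bounded B" unfolding bounded_def j using diam ne by blast
    show "diameter B \<le> \<delta>" using diam ne[of j] unfolding j
      by (auto simp: diameter_def intro!: cSUP_least)
  qed
qed

text \<open>Each covering set, enlarged by \<open>\<rho>\<close>, fits into a cube of edge
  \<open>2 * (\<delta> + \<rho>)\<close>. These cubes cover \<open>R\<close>, and comparing volumes
  bounds their number from below.\<close>

lemma covering_number_volume_bound:
  fixes S R :: "(real ^ 'm) set" and \<delta> \<rho> :: real
  assumes "coverable \<delta> S c" and \<delta>: "\<delta> \<ge> 0" "\<rho> \<ge> 0"
    and R: "R \<in> lmeasurable" and near: "\<And>x. x \<in> R \<Longrightarrow> \<exists>z\<in>S. dist x z \<le> \<rho>"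
  shows "measure lebesgue R \<le> covering_number \<delta> S * (2 * (\<delta> + \<rho>)) ^ CARD('m)"
proof -
  obtain F where F: "finite F" "real (card F) \<le> real (covering_number \<delta> S)"
     "\<forall>A\<in>F. bounded A \<and> diameter A \<le> \<delta>" "S \<subseteq> \<Union>F"
    using coverable_covering_number[OF assms(1)] unfolding coverable_def by blast
  \<comment> \<open>The cube is centred at an arbitrary point of \<open>A\<close>. For empty
    \<open>A\<close> the centre is unspecified, but the volume is still the right one.\<close>
  define D where "D = (\<lambda>A::(real^'m) set. let c = SOME x. x \<in> A in cbox (c - (\<chi> i. \<delta>+\<rho>)) (c + (\<chi> i. \<delta>+\<rho>)))"
  have D: "D A \<in> lmeasurable" "measure lebesgue (D A) = (2 * (\<delta> + \<rho>)) ^ CARD('m)" for A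
    using \<delta> by (auto simp: D_def Let_def content_cbox_if_cart interval_eq_empty_cart algebra_simps
        intro!: lmeasurable_cbox)
  have sub: "R \<subseteq> (\<Union>A\<in>F. D A)"
  proof
    fix x assume "x \<in> R"
    then obtain z where z: "z \<in> S" "dist x z \<le> \<rho>" using near by blast
    then obtain A where A: "A \<in> F" "z \<in> A" using F(4) by blast
    define c where "c = (SOME x. x \<in> A)"
    have "c \<in> A" using A unfolding c_def by (metis someI_ex)
    then have "dist z c \<le> \<delta>" using diameter_bounded_bound[of A z c] F(3) A by force
    then have "dist x c \<le> \<delta> + \<rho>" using z(2) dist_triangle[of x c z] by linarith
    then have "\<bar>(x - c) $ i\<bar> \<le> \<delta> + \<rho>" for i
      using component_le_norm_cart[of "x - c" i] by (simp add: dist_norm)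
    then have "x \<in> D A" unfolding D_def Let_def c_def[symmetric]
      by (auto simp: mem_box_cart abs_le_iff algebra_simps)
    then show "x \<in> (\<Union>A\<in>F. D A)" using A by blast
  qed
  have "measure lebesgue R \<le> measure lebesgue (\<Union>A\<in>F. D A)"
    by (rule measure_mono_fmeasurable[OF sub]) (use R D F(1) in \<open>auto intro!: fmeasurable.finite_UN\<close>)
  also have "\<dots> \<le> (\<Sum>A\<in>F. measure lebesgue (D A))"
    by (rule measure_UNION_le) (use F(1) D in auto)
  also have "\<dots> = real (card F) * (2 * (\<delta> + \<rho>)) ^ CARD('m)" using D by simp
  also have "\<dots> \<le> covering_number \<delta> S * (2 * (\<delta> + \<rho>)) ^ CARD('m)"
    using F(2) \<delta> by (intro mult_right_mono) auto
  finally show ?thesis .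
qed

text \<open>The constants \<open>C\<close> and \<open>c\<close> disappear after division by
  \<open>- ln \<delta>\<close>. For a limsup the lower bound is enough along one sequence of
  scales.\<close>

lemma upper_Minkowski_dim_eqI:
  fixes E :: "'a::metric_space set"
  assumes "0 \<le> d" and C: "1 \<le> C" "\<And>\<delta>. 0 < \<delta> \<Longrightarrow> \<delta> < 1 \<Longrightarrow> real (covering_number \<delta> E) \<le> C * \<delta> powr - d"
    and c: "0 < c" and \<eta>: "\<And>k. 0 < \<eta> k" "\<eta> \<longlonglongrightarrow> 0"
    and lower: "\<And>k. c * \<eta> k powr - d \<le> real (covering_number (\<eta> k) E)"
  shows "upper_Minkowski_dim E = ereal d"
proof (rule antisym)
  let ?X = "\<lambda>\<delta>::real. ereal (ln (real (covering_number \<delta> E)) / (- ln \<delta>))"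
  have lt1: "\<forall>\<^sub>F \<delta> in at_right 0. \<delta> < (1::real)"
    by (rule order_tendstoD(2)[OF tendsto_ident_at zero_less_one])
  have lim: "((\<lambda>\<delta>. ereal ((ln B - d * ln \<delta>) / (- ln \<delta>))) \<longlongrightarrow> ereal d) (at_right 0)" for B :: real
  proof -
    have "LIM \<delta> at_right (0::real). - ln \<delta> :> at_top"
      by (rule filterlim_compose[OF filterlim_uminus_at_top_at_bot ln_at_0])
    then have "((\<lambda>\<delta>. d + ln B / (- ln \<delta>)) \<longlongrightarrow> d + 0) (at_right 0)"
      by (intro tendsto_intros real_tendsto_divide_at_top[of _ "ln B"]) auto
    moreover have "\<forall>\<^sub>F \<delta> in at_right 0. \<delta> < (1::real)" by (rule lt1)
    then have "\<forall>\<^sub>F \<delta> in at_right 0. d + ln B / (- ln \<delta>) = (ln B - d * ln \<delta>) / (- ln \<delta>)"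
      using eventually_at_right_less
    proof eventually_elim
      case (elim \<delta>)
      then show ?case using ln_less_zero[of \<delta>] by (simp add: divide_simps)
    qed
    ultimately show ?thesis using tendsto_cong by fastforce
  qed
  have "\<forall>\<^sub>F \<delta> in at_right 0. \<delta> < (1::real)" by (rule lt1)
  then have "\<forall>\<^sub>F \<delta> in at_right 0. ?X \<delta> \<le> ereal ((ln C - d * ln \<delta>) / (- ln \<delta>))"
    using eventually_at_right_less
  proof eventually_elim
    case (elim \<delta>)
    have L: "0 < - ln \<delta>" using elim ln_less_zero[of \<delta>] by simp
    have "ln (real (covering_number \<delta> E)) \<le> ln (C * \<delta> powr - d)"
    \<comment> \<open>Since \<open>ln 0\<close> is \<open>0\<close>, a vanishing covering number
      requires the right-hand side to be non-negative, which follows from \<open>1 \<le> C\<close>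
      and \<open>0 \<le> d\<close>.\<close>
    proof (cases "covering_number \<delta> E = 0")
      case True
      have "1 \<le> \<delta> powr - d" using elim assms(1) powr_mono'[of "- d" 0 \<delta>] by simp
      then have "1 * 1 \<le> C * \<delta> powr - d" using C(1) by (intro mult_mono) auto
      then show ?thesis using True by simp
    next
      case False
      then show ?thesis using C(2)[of \<delta>] elim by (intro ln_mono) auto
    qed
    also have "\<dots> = ln C - d * ln \<delta>" using C(1) elim by (simp add: ln_mult ln_powr)
    finally show ?case using L by (simp add: divide_right_mono del: divide_minus_right)
  qed
  then have "upper_Minkowski_dim E \<le> Limsup (at_right 0) (\<lambda>\<delta>. ereal ((ln C - d * ln \<delta>) / (- ln \<delta>)))"
    unfolding upper_Minkowski_dim_def by (rule Limsup_mono)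
  also have "\<dots> = ereal d" by (rule lim_imp_Limsup[OF _ lim]) simp
  finally show "upper_Minkowski_dim E \<le> ereal d" .
  show "ereal d \<le> upper_Minkowski_dim E"
  proof (rule ccontr)
    assume "\<not> ereal d \<le> upper_Minkowski_dim E"
    then have "upper_Minkowski_dim E < ereal d" by simp
    then obtain y where y: "upper_Minkowski_dim E < y" "y < ereal d" using dense by blast
    \<comment> \<open>The scales \<open>\<eta> k\<close> tend to \<open>0\<close> from the right, so
      whatever holds for all small positive \<open>\<delta>\<close> holds at some
      \<open>\<eta> k\<close>.\<close>
    have fl: "filterlim \<eta> (at_right 0) sequentially"
      using \<eta> by (auto simp: filterlim_at less_imp_neq[OF \<eta>(1), symmetric])
    have "\<forall>\<^sub>F \<delta> in at_right 0. ?X \<delta> < y"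
      using y(1) unfolding upper_Minkowski_dim_def by (rule Limsup_lessD)
    moreover have "\<forall>\<^sub>F \<delta> in at_right 0. y < ereal ((ln c - d * ln \<delta>) / (- ln \<delta>))"
      using order_tendstoD(1)[OF lim y(2)] .
    moreover have "\<forall>\<^sub>F \<delta> in at_right 0. \<delta> < (1::real)" by (rule lt1)
    ultimately have "\<forall>\<^sub>F k in sequentially. ?X (\<eta> k) < y \<and> y < ereal ((ln c - d * ln (\<eta> k)) / (- ln (\<eta> k))) \<and> \<eta> k < 1"
      using filterlim_iff[THEN iffD1, OF fl] by (auto intro: eventually_conj)
    then obtain k where k: "?X (\<eta> k) < y" "y < ereal ((ln c - d * ln (\<eta> k)) / (- ln (\<eta> k)))" "\<eta> k < 1"
      using eventually_happens'[OF sequentially_bot] by blast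
    have L: "0 < - ln (\<eta> k)" using k(3) \<eta>(1)[of k] ln_less_zero[of "\<eta> k"] by simp
    have "ln c - d * ln (\<eta> k) = ln (c * \<eta> k powr - d)"
      using c \<eta>(1)[of k] by (simp add: ln_mult ln_powr)
    also have "\<dots> \<le> ln (real (covering_number (\<eta> k) E))"
      using lower[of k] c \<eta>(1)[of k] by (intro ln_mono) auto
    finally have "(ln c - d * ln (\<eta> k)) / (- ln (\<eta> k)) \<le> ln (real (covering_number (\<eta> k) E)) / (- ln (\<eta> k))"
      using L by (intro divide_right_mono) auto
    then have "ereal ((ln c - d * ln (\<eta> k)) / (- ln (\<eta> k))) \<le> ?X (\<eta> k)" by (simp only: ereal_less_eq)
    then show False using k(1,2) by (meson less_trans not_less)
  qed
qed

text \<open>In the boxes below only two edges depend on the spikes. Every other edge has length at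
  most 4 and contributes a factor of order \<open>1 / \<delta>\<close>.\<close>

lemma coverable_cbox_two_sides:
  fixes a b :: "real ^ 'm"
  assumes ij: "i \<noteq> j" and d: "0 < \<delta>" "\<delta> \<le> 1" and ab: "\<And>k. a $ k \<le> b $ k" "\<And>k. b $ k - a $ k \<le> 4"
  shows "coverable \<delta> (cbox a b) ((CARD('m) * (b $ i - a $ i) / \<delta> + 1) * (CARD('m) * (b $ j - a $ j) / \<delta> + 1)
           * ((4 * CARD('m) + 1) / \<delta>) ^ (CARD('m) - 2))"
proof -
  let ?f = "\<lambda>k. CARD('m) * (b $ k - a $ k) / \<delta> + 1"
  have f0: "0 \<le> ?f k" for k using ab(1)[of k] d by simp
  have "(\<Prod>k\<in>UNIV. ?f k) = ?f i * (?f j * (\<Prod>k\<in>UNIV - {i} - {j}. ?f k))"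
    using ij by (simp add: prod.remove[of UNIV i] prod.remove[of "UNIV - {i}" j])
  also have "(\<Prod>k\<in>UNIV - {i} - {j}. ?f k) \<le> (\<Prod>k\<in>UNIV - {i} - {j}. (4 * CARD('m) + 1) / \<delta>)"
  proof (rule prod_mono, safe)
    fix k
    show "0 \<le> ?f k" by (rule f0)
    have "CARD('m) * (b $ k - a $ k) \<le> real CARD('m) * 4" using ab(2) by (intro mult_left_mono) auto
    then have "CARD('m) * (b $ k - a $ k) / \<delta> \<le> real CARD('m) * 4 / \<delta>"
      using d by (intro divide_right_mono) auto
    moreover have "1 \<le> 1 / \<delta>" using d by simp
    ultimately show "?f k \<le> (4 * CARD('m) + 1) / \<delta>" by (simp add: add_divide_distrib mult.commute)
  qed
  also have "\<dots> = ((4 * CARD('m) + 1) / \<delta>) ^ (CARD('m) - 2)"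
    using ij by (simp add: card_Diff_singleton numeral_2_eq_2)
  finally have "(\<Prod>k\<in>UNIV. ?f k) \<le> ?f i * (?f j * ((4 * CARD('m) + 1) / \<delta>) ^ (CARD('m) - 2))"
    using f0 by (simp add: mult_left_mono)
  then show ?thesis
    by (intro coverable_mono[OF coverable_cbox[OF d(1) ab(1)]]) (auto simp: mult.assoc)
qed

section \<open>Marcinkiewicz integrals over convex sets\<close>

lemma emeasure_lborel_open_bounded:
  fixes K :: "'a::euclidean_space set"
  assumes "open K" "bounded K"
  shows "emeasure lborel K = ennreal (measure lebesgue K)"
proof -
  have "K \<in> lmeasurable" using assms by (simp add: lmeasurable_open)
  then have "emeasure lebesgue K = ennreal (measure lebesgue K)"
    by (rule emeasure_eq_measure2)
  then show ?thesis using assms by simp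
qed

lemma ennreal_le_suminf: "(f k :: ennreal) \<le> suminf f"
  using sum_le_suminf[of f "{k}"] by simp

lemma convex_shrink_measure:
  fixes K :: "'a::euclidean_space set" and r s :: real
  assumes K: "open K" "convex K" "bounded K" and r: "ball c r \<subseteq> K" "0 < r"
    and S: "S \<noteq> {}" "S \<inter> K = {}" and s: "0 \<le> s"
  shows "emeasure lborel {x\<in>K. infdist x S < s * r} \<le> ennreal (DIM('a) * s * measure lebesgue K)"
proof (cases "s < 1")
  case False
  have "emeasure lborel {x\<in>K. infdist x S < s * r} \<le> emeasure lborel K"
    by (rule emeasure_mono) (use K in auto)
  also have "\<dots> = ennreal (measure lebesgue K)"
    using K by (simp add: emeasure_lborel_open_bounded)
  also have "\<dots> \<le> ennreal (DIM('a) * s * measure lebesgue K)"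
  proof -
    have "1 * 1 \<le> real (DIM('a)) * s" using False DIM_positive[where 'a='a] by (intro mult_mono) auto
    then have "1 * measure lebesgue K \<le> (DIM('a) * s) * measure lebesgue K" by (intro mult_right_mono) auto
    then show ?thesis by (intro ennreal_leI) simp
  qed
  finally show ?thesis .
next
  case s1: True
  define T where "T = (\<lambda>x. (1 - s) *\<^sub>R x + s *\<^sub>R c)"
  have TK: "T ` K \<subseteq> K"
  proof
    fix y assume "y \<in> T ` K"
    then obtain x where "x \<in> K" "y = T x" by blast
    moreover have "c \<in> K" using r by auto
    ultimately show "y \<in> K" unfolding T_def using K(2) s s1 by (auto intro: convexD)
  qed
  have far: "s * r \<le> infdist y S" if y: "y \<in> T ` K" for y
  proof -
    obtain x where x: "x \<in> K" "y = T x" using y by blast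
    have "s * r \<le> dist y z" if "z \<in> S" for z
    proof (rule ccontr)
      assume "\<not> s * r \<le> dist y z"
      then have d: "dist y z < s * r" by simp
      then have "s > 0" using r s by (metis zero_le_dist mult_zero_left not_le order_le_less)
      \<comment> \<open>If \<open>z\<close> were closer to \<open>y = T x\<close> than
        \<open>s * r\<close>, then \<open>v\<close> would lie in the ball, and \<open>z\<close>, a
        convex combination of \<open>x\<close> and \<open>v\<close>, would lie in
        \<open>K\<close>.\<close>
      define v where "v = c + (1/s) *\<^sub>R (z - y)"
      have "dist c v = dist y z / s" using \<open>s > 0\<close> by (simp add: v_def dist_norm norm_minus_commute)
      then have "dist c v < r" using d \<open>s > 0\<close> by (simp add: pos_divide_less_eq mult.commute)
      then have "v \<in> K" using r by auto
      moreover have "z = (1 - s) *\<^sub>R x + s *\<^sub>R v"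
        using \<open>s > 0\<close> x(2) by (simp add: v_def T_def algebra_simps)
      ultimately have "z \<in> K" using x K(2) s s1 by (auto intro: convexD)
      then show False using S(2) that by blast
    qed
    then show ?thesis using S by (auto simp: infdist_def intro!: cINF_greatest)
  qed
  have Tm: "measure lebesgue (T ` K) = (1 - s) ^ DIM('a) * measure lebesgue K"
    using measure_lebesgue_affine[of "1 - s" "s *\<^sub>R c" K] s1 by (simp add: T_def)
  have Kl: "K \<in> lmeasurable" using K by (simp add: lmeasurable_open)
  have To: "open (T ` K)"
  proof -
    have "T ` K = (\<lambda>x. s *\<^sub>R c + x) ` ((*\<^sub>R) (1 - s) ` K)" by (auto simp: T_def image_image add.commute)
    then show ?thesis using open_scaling[of "1 - s" K] s1 K(1) open_translation by simp
  qed
  have Tl: "T ` K \<in> lmeasurable"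
    using To bounded_subset[OF K(3) TK] by (simp add: lmeasurable_open)
  have "emeasure lborel {x\<in>K. infdist x S < s * r} \<le> emeasure lborel (K - T ` K)"
    by (rule emeasure_mono) (use far K To in \<open>force+\<close>)
  also have "\<dots> = emeasure lebesgue (K - T ` K)" using K To by simp
  also have "\<dots> = ennreal (measure lebesgue (K - T ` K))"
    using Kl Tl by (intro emeasure_eq_measure2) auto
  also have "measure lebesgue (K - T ` K) = measure lebesgue K - (1 - s) ^ DIM('a) * measure lebesgue K"
    using measurable_measure_Diff[of K lebesgue "T ` K"] Kl Tl TK Tm by (simp add: fmeasurableD)
  also have "\<dots> = (1 - (1 - s) ^ DIM('a)) * measure lebesgue K" by (simp add: algebra_simps)
  also have "\<dots> \<le> (DIM('a) * s) * measure lebesgue K"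
    using Bernoulli_inequality[of "- s" "DIM('a)"] s1 by (intro mult_right_mono) auto
  finally show ?thesis by (simp add: ennreal_leI)
qed

text \<open>A value \<open>u\<close> below \<open>r\<close> lies between
  \<open>r / 2 ^ (j + 1)\<close> and \<open>r / 2 ^ j\<close> for some \<open>j\<close>, and the
  \<open>j\<close>-th term alone dominates the left-hand side. The summand 1 handles
  \<open>r \<le> u\<close>.\<close>

lemma inverse_powr_le_dyadic_suminf:
  fixes u r p :: real
  assumes r: "0 < r" and p: "0 < p" and u0: "0 \<le> u"
  shows "ennreal (1 / u powr p) \<le> ennreal (r powr - p) *
           (1 + (suminf (\<lambda>j. ennreal (2 powr (p * (real j + 1))) * indicator {..< (1/2)^j * r} u)))"
    (is "_ \<le> _ * (1 + suminf ?f)")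
proof (cases "u = 0")
  \<comment> \<open>Here \<open>0 powr p\<close> is \<open>0\<close> and division by zero gives
    \<open>0\<close>, so the left-hand side vanishes.\<close>
  case True
  then show ?thesis by simp
next
  case False
  then have u: "u > 0" using u0 by simp
  show ?thesis
  proof (cases "r \<le> u")
    case True
    have "1 / u powr p = u powr - p" by (simp add: powr_minus_divide)
    also have "\<dots> \<le> r powr - p" using True r p by (simp add: powr_mono2')
    finally have "ennreal (1 / u powr p) \<le> ennreal (r powr - p) * 1" by (simp add: ennreal_leI)
    also have "\<dots> \<le> ennreal (r powr - p) * (1 + suminf ?f)" by (intro mult_left_mono) auto
    finally show ?thesis .
  next
    case False
    obtain j0 where "(1/2)^j0 < u / r"
      using real_arch_pow_inv[of "u/r" "1/2"] u r by auto
    then have ex: "(1/2)^Suc j0 * r \<le> u" using r u by (simp add: field_simps)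
    \<comment> \<open>Minimality of \<open>j\<close> gives the upper bound
      \<open>u < (1/2)^j * r\<close>; for \<open>j = 0\<close> it is the case assumption.\<close>
    define j where "j = (LEAST j. (1/2)^Suc j * r \<le> u)"
    have j: "(1/2)^Suc j * r \<le> u" unfolding j_def by (rule LeastI[of _ j0]) (rule ex)
    have j': "u < (1/2)^j * r"
    proof (cases j)
      case 0
      then show ?thesis using False by simp
    next
      case (Suc i)
      then have "\<not> (1/2)^Suc i * r \<le> u" unfolding j_def by (metis lessI not_less_Least)
      then show ?thesis using Suc by simp
    qed
    have "1 / u powr p = u powr - p" by (simp add: powr_minus_divide)
    also have "\<dots> \<le> ((1/2)^Suc j * r) powr - p" using j r p by (simp add: powr_mono2')
    also have "\<dots> = r powr - p * ((1/2)^Suc j) powr - p" using r by (simp add: powr_mult mult.commute del: power_Suc)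
    also have "((1/2::real)^Suc j) powr - p = 2 powr (p * (real j + 1))"
    proof -
      have "2 powr (real j + 1) = 2 ^ Suc j" by (simp add: powr_add powr_realpow)
      then have "(1/2::real)^Suc j = 2 powr - (real j + 1)"
        unfolding powr_minus by (simp add: power_one_over inverse_eq_divide)
      then show ?thesis by (simp add: powr_powr algebra_simps)
    qed
    finally have "ennreal (1 / u powr p) \<le> ennreal (r powr - p) * ennreal (2 powr (p * (real j + 1)))"
      by (simp add: ennreal_leI flip: ennreal_mult)
    also have "ennreal (2 powr (p * (real j + 1))) = ?f j" using j' by simp
    also have "?f j \<le> suminf ?f"
      by (rule ennreal_le_suminf)
    also have "suminf ?f \<le> 1 + suminf ?f" by simp
    finally show ?thesis by (simp add: mult_left_mono)
  qed
qed

text \<open>The integrand is split dyadically by distance. The \<open>j\<close>-th layer has volume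
  of order \<open>2 ^ (- j)\<close> relative to \<open>K\<close> and weight of order
  \<open>2 powr (p * j)\<close>, so the layers sum to a geometric series with ratio
  \<open>2 powr (p - 1)\<close>.\<close>

lemma Marcinkiewicz_integral_convex:
  fixes K :: "'a::euclidean_space set"
  assumes K: "open K" "convex K" "bounded K" and r: "ball c r \<subseteq> K" "0 < r"
    and S: "S \<noteq> {}" "S \<inter> K = {}" and p: "0 < p" "p < 1"
  shows "Marcinkiewicz_integral S p K
     \<le> ennreal ((1 + DIM('a) * 2 powr p / (1 - 2 powr (p - 1))) * (measure lebesgue K * r powr - p))"
proof -
  let ?V = "measure lebesgue K" and ?N = "real DIM('a)"
  let ?E = "\<lambda>j. {x\<in>K. infdist x S < (1/2)^j * r}"
  let ?f = "\<lambda>j u. ennreal (2 powr (p * (real j + 1))) * indicator {..< (1/2)^j * r} u"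
  have Kb[measurable]: "K \<in> sets borel" using K by simp
  have inf_m[measurable]: "(\<lambda>x. infdist x S) \<in> borel_measurable borel"
    by (intro borel_measurable_continuous_onI continuous_intros)
  have Em[measurable]: "?E j \<in> sets borel" for j by measurable
  have "Marcinkiewicz_integral S p K
     \<le> (\<integral>\<^sup>+x. ennreal (r powr - p) * (indicator K x + (suminf (\<lambda>j. ennreal (2 powr (p * (real j + 1))) * indicator (?E j) x))) \<partial>lborel)"
    unfolding Marcinkiewicz_integral_def
  proof (rule nn_integral_mono)
    fix x
    show "ennreal (1 / infdist x S powr p) * indicator K x \<le>
       ennreal (r powr - p) * (indicator K x + (suminf (\<lambda>j. ennreal (2 powr (p * (real j + 1))) * indicator (?E j) x)))"
    proof (cases "x \<in> K")
      case True
      have "(suminf (\<lambda>j. ?f j (infdist x S))) = suminf (\<lambda>j. ennreal (2 powr (p * (real j + 1))) * indicator (?E j) x)"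
        using True by (intro suminf_cong) (auto simp: indicator_def)
      then show ?thesis
        using inverse_powr_le_dyadic_suminf[OF r(2) p(1) infdist_nonneg[of x S]] True by simp
    qed simp
  qed
  also have "\<dots> = ennreal (r powr - p) * (emeasure lborel K + (suminf (\<lambda>j. ennreal (2 powr (p * (real j + 1))) * emeasure lborel (?E j))))"
    by (simp add: nn_integral_cmult nn_integral_add nn_integral_suminf nn_integral_cmult_indicator)
  also have "\<dots> \<le> ennreal (r powr - p) * (ennreal ?V + ennreal (?N * 2 powr p / (1 - 2 powr (p - 1)) * ?V))"
  proof (intro mult_left_mono add_mono)
    show "emeasure lborel K \<le> ennreal ?V"
      using K by (simp add: emeasure_lborel_open_bounded)
    \<comment> \<open>The assumption \<open>p < 1\<close> is what makes the geometric series
      converge.\<close>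
    have q: "2 powr (p - 1) < 1" using p powr_less_mono[of "p - 1" 0 2] by simp
    have t: "ennreal (2 powr (p * (real j + 1))) * emeasure lborel (?E j)
       \<le> ennreal (?N * 2 powr p * ?V * (2 powr (p - 1)) ^ j)" for j
    proof -
      have "ennreal (2 powr (p * (real j + 1))) * emeasure lborel (?E j)
        \<le> ennreal (2 powr (p * (real j + 1))) * ennreal (?N * (1/2)^j * ?V)"
        using convex_shrink_measure[OF K r S, of "(1/2)^j"] by (intro mult_left_mono) auto
      also have "\<dots> = ennreal (2 powr (p * (real j + 1)) * (?N * (1/2)^j * ?V))"
        by (simp add: ennreal_mult)
      also have "2 powr (p * (real j + 1)) * (?N * (1/2)^j * ?V) = ?N * 2 powr p * ?V * (2 powr (p - 1)) ^ j"
      proof -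
        have "2 powr (p * (real j + 1)) = 2 powr p * (2 powr p) ^ j"
          by (simp add: powr_add powr_powr flip: powr_realpow) (simp add: algebra_simps powr_add)
        moreover have "(2 powr (p - 1)) ^ j = (2 powr p) ^ j * (1/2)^j"
          by (simp add: powr_diff power_divide)
        ultimately show ?thesis by simp
      qed
      finally show ?thesis .
    qed
    have "(suminf (\<lambda>j. ennreal (2 powr (p * (real j + 1))) * emeasure lborel (?E j)))
        \<le> suminf (\<lambda>j. ennreal (?N * 2 powr p * ?V * (2 powr (p - 1)) ^ j))"
      by (intro suminf_le t) auto
    also have "\<dots> = ennreal (suminf (\<lambda>j. ?N * 2 powr p * ?V * (2 powr (p - 1)) ^ j))"
      using q by (intro suminf_ennreal2) (auto intro!: summable_mult)
    also have "(suminf (\<lambda>j. ?N * 2 powr p * ?V * (2 powr (p - 1)) ^ j)) = ?N * 2 powr p / (1 - 2 powr (p - 1)) * ?V"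
      using q by (simp add: suminf_mult suminf_geometric)
    finally show "(suminf (\<lambda>j. ennreal (2 powr (p * (real j + 1))) * emeasure lborel (?E j)))
       \<le> ennreal (?N * 2 powr p / (1 - 2 powr (p - 1)) * ?V)" .
  qed simp
  also have "\<dots> = ennreal ((1 + ?N * 2 powr p / (1 - 2 powr (p - 1))) * (?V * r powr - p))"
  proof -
    have "2 powr (p - 1) < 1" using p powr_less_mono[of "p - 1" 0 2] by simp
    then show ?thesis
      by (simp add: algebra_simps flip: ennreal_mult ennreal_plus)
  qed
  finally show ?thesis .
qed

lemma Marcinkiewicz_integral_UN:
  fixes K :: "nat \<Rightarrow> 'a::euclidean_space set"
  assumes "\<And>k. K k \<in> sets borel"
  shows "Marcinkiewicz_integral S p (\<Union>k. K k) \<le> suminf (\<lambda>k. Marcinkiewicz_integral S p (K k))"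
proof -
  have [measurable]: "K k \<in> sets borel" for k by fact
  have [measurable]: "(\<lambda>x. infdist x S) \<in> borel_measurable borel"
    by (intro borel_measurable_continuous_onI continuous_intros)
  have "Marcinkiewicz_integral S p (\<Union>k. K k)
      \<le> (\<integral>\<^sup>+x. (suminf (\<lambda>k. ennreal (1 / infdist x S powr p) * indicator (K k) x)) \<partial>lborel)"
    unfolding Marcinkiewicz_integral_def
  proof (rule nn_integral_mono)
    fix x
    let ?F = "\<lambda>k. ennreal (1 / infdist x S powr p) * indicator (K k) x"
    show "ennreal (1 / infdist x S powr p) * indicator (\<Union>k. K k) x \<le> suminf (\<lambda>k. ?F k)"
    proof (cases "x \<in> (\<Union>k. K k)")
      case True
      then obtain k where k: "x \<in> K k" by blast
      have "?F k \<le> suminf ?F" by (rule ennreal_le_suminf)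
      then show ?thesis using True k by simp
    qed simp
  qed
  also have "\<dots> = suminf (\<lambda>k. Marcinkiewicz_integral S p (K k))"
    unfolding Marcinkiewicz_integral_def by (rule nn_integral_suminf) measurable
  finally show ?thesis .
qed

section \<open>Images of convex bodies under homeomorphisms\<close>

lemma connected_component_set_separated:
  assumes "open A" "open B" "A \<inter> B = {}" "connected A" "x \<in> A"
  shows "connected_component_set (A \<union> B) x = A"
proof (rule connected_component_unique)
  show "x \<in> A" "A \<subseteq> A \<union> B" "connected A" using assms by auto
  fix c assume c: "x \<in> c" "c \<subseteq> A \<union> B" "connected c"
  then have "B \<inter> c = {}" using connectedD[OF c(3) assms(1,2)] assms by blast
  then show "c \<subseteq> A" using c by blast
qed

lemma inside_outside_separated:
  fixes S :: "'a::real_normed_vector set"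
  assumes "- S = A \<union> B" and AB: "open A" "open B" "A \<inter> B = {}" "connected A" "connected B"
    and bd: "bounded A" "\<not> bounded B" and "A \<noteq> {}"
  shows "inside S = A" "outside S = B" "components (- S) = {A, B}"
proof -
  have A: "connected_component_set (- S) x = A" if "x \<in> A" for x
    using connected_component_set_separated[OF AB(1-4) that] assms(1) by simp
  have B: "connected_component_set (- S) x = B" if "x \<in> B" for x
    using connected_component_set_separated[OF AB(2,1) _ AB(5) that] assms(1) AB(3)
    by (simp add: Un_commute Int_commute)
  have S: "x \<notin> S \<longleftrightarrow> x \<in> A \<union> B" for x using assms(1) by auto
  show "inside S = A" using A B bd AB(3) S unfolding inside_def by blast
  show "outside S = B" using A B bd AB(3) assms(1) unfolding outside_def by auto
  have "B \<noteq> {}" using bd by auto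
  then show "components (- S) = {A, B}"
    using A B \<open>A \<noteq> {}\<close> unfolding components_def assms(1)[symmetric] using S by auto
qed

context
  fixes f h :: "'a::euclidean_space \<Rightarrow> 'a" and K :: "'a set"
  assumes fh: "homeomorphism UNIV UNIV f h"
    and K: "open K" "convex K" "bounded K" "K \<noteq> {}"
begin

lemma frontier_open_convex_image: "f ` frontier K = f ` closure K - f ` K"
proof -
  have "inj f" by (rule inj_on_inverseI[of _ h]) (use fh in \<open>auto simp: homeomorphism_def\<close>)
  then show ?thesis using K by (simp add: frontier_def interior_open image_set_diff)
qed

text \<open>In dimension at least 2 the complement of a bounded convex closure is connected. The
  homeomorphism carries \<open>K\<close> and this complement to two connected open sets that
  partition the complement of the image surface; compactness of the closure tells which one is
  bounded.\<close>

lemma homeomorphic_convex_image_inside: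
  assumes dim: "2 \<le> DIM('a)"
  shows "inside (f ` frontier K) = f ` K" "boundary_of_Jordan_domain (f ` frontier K)"
proof -
  let ?S = "f ` frontier K" and ?A = "f ` K" and ?B = "f ` (- closure K)"
  have inj: "inj f" by (rule inj_on_inverseI[of _ h]) (use fh in \<open>auto simp: homeomorphism_def\<close>)
  have surj: "f ` UNIV = UNIV" using fh by (simp add: homeomorphism_def)
  have cont: "continuous_on T f" for T
    using fh by (metis homeomorphism_cont1 continuous_on_subset subset_UNIV)
  have op: "open (f ` T)" if "open T" for T
    using homeomorphism_imp_open_map[OF fh, of T] that by simp
  have cc: "compact (f ` closure K)"
    using K by (intro compact_continuous_image cont) (simp add: compact_closure)
  have comp: "- ?S = ?A \<union> ?B"
  proof -
    have "- frontier K = K \<union> - closure K"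
      using K closure_subset[of K] by (auto simp: frontier_def interior_open)
    then have "f ` (- frontier K) = ?A \<union> ?B" by (simp add: image_Un)
    then show ?thesis using bij_image_Compl_eq[of f "frontier K"] inj surj by (simp add: bij_def)
  qed
  have disj: "?A \<inter> ?B = {}"
    using closure_subset[of K] inj by (auto simp: inj_on_def)
  have "connected (- closure K)"
    using K dim by (intro connected_complement_bounded_convex) (auto simp: convex_closure)
  then have cB: "connected ?B" by (intro connected_continuous_image cont)
  have cA: "connected ?A"
    using K by (intro connected_continuous_image cont) (simp add: convex_connected)
  have bA: "bounded ?A"
    by (rule bounded_subset[OF compact_imp_bounded[OF cc]]) (use closure_subset in blast)
  \<comment> \<open>Otherwise the whole space, being the image of \<open>closure K\<close> together
    with \<open>?B\<close>, would be bounded.\<close>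
  have nB: "\<not> bounded ?B"
  proof
    assume "bounded ?B"
    then have "bounded (f ` closure K \<union> ?B)" using compact_imp_bounded[OF cc] by simp
    moreover have "f ` closure K \<union> ?B = UNIV" using surj by (metis image_Un Compl_partition)
    ultimately show False using not_bounded_UNIV by metis
  qed
  note sep = inside_outside_separated[OF comp op[OF K(1)] op[of "- closure K"] disj cA cB bA nB]
  show ins: "inside ?S = ?A" using sep(1) K by (auto simp: open_Compl)
  have "closure ?A = f ` closure K"
  proof
    show "closure ?A \<subseteq> f ` closure K"
      by (rule closure_minimal) (use closure_subset cc compact_imp_closed in blast)+
    show "f ` closure K \<subseteq> closure ?A"
      by (rule image_closure_subset) (use cont closure_subset[of "f ` K"] in auto)
  qed
  then have "frontier ?A = ?S"
    using op[OF K(1)] frontier_open_convex_image by (simp add: frontier_def interior_open)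
  then show "boundary_of_Jordan_domain ?S"
    unfolding boundary_of_Jordan_domain_def using sep(2,3) K ins by (simp add: open_Compl)
qed

text \<open>As for stereographic projection, the boundary of a convex body minus one point is
  homeomorphic to a hyperplane \<open>H\<close>. A chart at \<open>x\<close> is the surface with
  some other point \<open>y\<close> removed, so no local construction is required.\<close>

lemma homeomorphic_convex_image_hypersurface:
  assumes dim: "DIM('a) = n + 1" and n: "0 < n"
  shows "compact_topological_hypersurface n (f ` frontier K)"
  unfolding compact_topological_hypersurface_def
proof (intro conjI ballI)
  let ?S = "f ` frontier K"
  show "DIM('a) = n + 1" by fact
  have cont: "continuous_on T f" for T
    using fh by (metis homeomorphism_cont1 continuous_on_subset subset_UNIV)
  have inj: "inj f" by (rule inj_on_inverseI[of _ h]) (use fh in \<open>auto simp: homeomorphism_def\<close>)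
  show "compact ?S"
    using K by (intro compact_continuous_image cont) (simp add: compact_frontier_bounded)
  fix x assume x: "x \<in> ?S"
  obtain H :: "'a set" where H: "affine H" "aff_dim H = n"
  proof -
    have "int n \<le> aff_dim (UNIV :: 'a set)" using dim by (simp only: aff_dim_UNIV)
    then obtain H :: "'a set" where "affine H" "aff_dim H = int n"
      using choose_affine_subset[OF affine_UNIV, of "int n"] by force
    then show thesis using that by blast
  qed
  have rf: "rel_frontier K = frontier K"
    using K by (intro rel_frontier_frontier affine_hull_open) auto
  have punctured: "frontier K - {v} homeomorphic H" if "v \<in> frontier K" for v
    using homeomorphic_punctured_sphere_affine_gen[of K v H] K that H rf dim
    by (simp add: aff_dim_open)
  obtain u where u: "u \<in> frontier K" "x = f u" using x by blast
  \<comment> \<open>A second boundary point exists because the punctured boundary is homeomorphic to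
    the non-empty \<open>H\<close>.\<close>
  have "H \<noteq> {}" using H(2) by auto
  then have "frontier K - {u} \<noteq> {}"
    using punctured[OF u(1)] homeomorphic_empty by metis
  then obtain v where v: "v \<in> frontier K" "v \<noteq> u" by blast
  define y where "y = f v"
  have y: "y \<in> ?S" "y \<noteq> x" using u v inj by (auto simp: y_def inj_eq)
  have "frontier K - {v} homeomorphic H" using punctured v by blast
  moreover have "?S - {y} homeomorphic frontier K - {v}"
  proof -
    have "homeomorphism (frontier K - {v}) (f ` (frontier K - {v})) f h"
      using fh by (rule homeomorphism_of_subsets) auto
    moreover have "f ` (frontier K - {v}) = ?S - {y}"
      using v inj by (auto simp: y_def inj_eq)
    ultimately show ?thesis using homeomorphic_def homeomorphic_sym by metis
  qed
  ultimately have "?S - {y} homeomorphic H" using homeomorphic_trans by blast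
  then have "top_of_set (?S - {y}) homeomorphic_space top_of_set H"
    by simp
  then have "top_of_set (?S - {y}) homeomorphic_space Euclidean_space n"
    using homeomorphic_affine_Euclidean_space[OF H(1), of n] H(2) homeomorphic_space_trans by blast
  then show "\<exists>U V. openin (top_of_set ?S) U \<and> x \<in> U \<and> openin (Euclidean_space n) V \<and>
        top_of_set U homeomorphic_space subtopology (Euclidean_space n) V"
    using x y by (intro exI[of _ "?S - {y}"] exI[of _ "topspace (Euclidean_space n)"])
      (auto intro!: openin_delete)
qed

end

section \<open>Vertical stretching of the cube\<close>

definition stretch :: "'m \<Rightarrow> 'm \<Rightarrow> (real \<Rightarrow> real) \<Rightarrow> real ^ 'm \<Rightarrow> real ^ 'm" where
  "stretch i\<^sub>0 i\<^sub>1 g x = (\<chi> i. if i = i\<^sub>0 then (1 + g (x $ i\<^sub>1)) * x $ i\<^sub>0 else x $ i)"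

text \<open>Direction \<open>i\<^sub>0\<close> is vertical. Since
  \<open>i\<^sub>0 \<noteq> i\<^sub>1\<close>, the map leaves the coordinate that determines its
  factor unchanged, so dividing by the same factor inverts it.\<close>

lemma homeomorphism_stretch:
  fixes i\<^sub>0 i\<^sub>1 :: "'m::finite"
  assumes "i\<^sub>0 \<noteq> i\<^sub>1" and g: "continuous_on UNIV g" "\<And>t. 0 \<le> g t"
  shows "homeomorphism UNIV UNIV (stretch i\<^sub>0 i\<^sub>1 g) (\<lambda>x. \<chi> i. if i = i\<^sub>0 then x $ i\<^sub>0 / (1 + g (x $ i\<^sub>1)) else x $ i)"
    (is "homeomorphism _ _ ?f ?h")
proof -
  have pos: "1 + g t \<noteq> 0" for t using g(2)[of t] by linarith
  have gc: "continuous_on UNIV (\<lambda>x::real^'m. g (x $ i\<^sub>1))"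
    by (rule continuous_on_compose2[OF g(1)]) (auto intro!: continuous_intros)
  have "?h (?f x) = x" "?f (?h x) = x" for x
    using assms(1) pos by (auto simp: stretch_def vec_eq_iff)
  moreover have "continuous_on UNIV ?f"
    unfolding stretch_def
    by (rule continuous_on_vec_lambda, rename_tac i, case_tac "i = i\<^sub>0"; simp; intro continuous_intros gc)
  moreover have "continuous_on UNIV ?h"
    by (rule continuous_on_vec_lambda, rename_tac i, case_tac "i = i\<^sub>0"; simp;
        intro continuous_intros gc ballI pos)
  ultimately show ?thesis by (intro homeomorphismI) auto
qed

lemma stretch_box:
  fixes i\<^sub>0 i\<^sub>1 :: "'m::finite"
  assumes "i\<^sub>0 \<noteq> i\<^sub>1" and g: "\<And>t. 0 \<le> g t"
  shows "stretch i\<^sub>0 i\<^sub>1 g ` box (-1) 1 =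
    {x. (\<forall>i. i \<noteq> i\<^sub>0 \<longrightarrow> \<bar>x $ i\<bar> < 1) \<and> \<bar>x $ i\<^sub>0\<bar> < 1 + g (x $ i\<^sub>1)}" (is "_ = ?R")
    and "stretch i\<^sub>0 i\<^sub>1 g ` cbox (-1) 1 =
    {x. (\<forall>i. i \<noteq> i\<^sub>0 \<longrightarrow> \<bar>x $ i\<bar> \<le> 1) \<and> \<bar>x $ i\<^sub>0\<bar> \<le> 1 + g (x $ i\<^sub>1)}" (is "_ = ?C")
proof -
  let ?h = "\<lambda>x. \<chi> i. if i = i\<^sub>0 then x $ i\<^sub>0 / (1 + g (x $ i\<^sub>1)) else x $ i"
  have pos: "0 < 1 + g t" for t using g[of t] by linarith
  have fh: "stretch i\<^sub>0 i\<^sub>1 g (?h x) = x" for x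
    using assms(1) pos by (auto simp: stretch_def vec_eq_iff less_imp_neq[OF pos, symmetric])
  have b: "x \<in> box (-1) 1 \<longleftrightarrow> (\<forall>i. \<bar>x $ i\<bar> < 1)" for x :: "real^'m"
    by (auto simp: mem_box_cart abs_less_iff minus_less_iff)
  have c: "x \<in> cbox (-1) 1 \<longleftrightarrow> (\<forall>i. \<bar>x $ i\<bar> \<le> 1)" for x :: "real^'m"
    by (auto simp: mem_box_cart abs_le_iff minus_le_iff)
  have scale: "\<bar>c * y\<bar> < c \<longleftrightarrow> \<bar>y\<bar> < 1" "\<bar>c * y\<bar> \<le> c \<longleftrightarrow> \<bar>y\<bar> \<le> 1" if "0 < c" for c y :: real
    using that by (simp_all add: abs_mult)
  have R: "stretch i\<^sub>0 i\<^sub>1 g x \<in> ?R" if "x \<in> box (-1) 1" for x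
    using that assms(1) unfolding b by (simp add: stretch_def scale[OF pos])
  have R': "?h x \<in> box (-1) 1" if "x \<in> ?R" for x
    using that unfolding b by (simp add: pos abs_of_pos[OF pos])
  show "stretch i\<^sub>0 i\<^sub>1 g ` box (-1) 1 = ?R"
  proof (intro equalityI subsetI)
    fix y assume "y \<in> ?R"
    then have "stretch i\<^sub>0 i\<^sub>1 g (?h y) \<in> stretch i\<^sub>0 i\<^sub>1 g ` box (-1) 1" by (intro imageI R')
    then show "y \<in> stretch i\<^sub>0 i\<^sub>1 g ` box (-1) 1" unfolding fh .
  qed (use R in blast)
  have C: "stretch i\<^sub>0 i\<^sub>1 g x \<in> ?C" if "x \<in> cbox (-1) 1" for x
    using that assms(1) unfolding c by (simp add: stretch_def scale[OF pos])
  have C': "?h x \<in> cbox (-1) 1" if "x \<in> ?C" for x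
    using that unfolding c by (simp add: pos abs_of_pos[OF pos])
  show "stretch i\<^sub>0 i\<^sub>1 g ` cbox (-1) 1 = ?C"
  proof (intro equalityI subsetI)
    fix y assume "y \<in> ?C"
    then have "stretch i\<^sub>0 i\<^sub>1 g (?h y) \<in> stretch i\<^sub>0 i\<^sub>1 g ` cbox (-1) 1" by (intro imageI C')
    then show "y \<in> stretch i\<^sub>0 i\<^sub>1 g ` cbox (-1) 1" unfolding fh .
  qed (use C in blast)
qed

section \<open>Spikes accumulating at a point\<close>

text \<open>Only finitely many values exceed half of the positive supremum, so the supremum is a
  maximum over these.\<close>

lemma Sup_attained_of_vanishing_bound:
  fixes F h :: "nat \<Rightarrow> real"
  assumes F: "\<And>k. F k \<le> h k" and h: "h \<longlonglongrightarrow> 0" and pos: "0 < (SUP k. F k)"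
  obtains k where "(SUP k. F k) = F k"
proof (rule ccontr)
  assume *: "\<not> thesis"
  define s where "s = (SUP k. F k)"
  obtain B where "\<And>k. h k \<le> B"
    using convergent_imp_Bseq[OF convergentI[OF h]] by (auto simp: Bseq_def abs_le_iff)
  then have bdd: "bdd_above (range F)" using F by (meson bdd_above.I2 order_trans)
  have le: "F k \<le> s" for k unfolding s_def using bdd by (simp add: cSUP_upper)
  then have lt: "F k < s" for k using * that unfolding s_def by (metis order_le_less)
  have "eventually (\<lambda>k. h k < s / 2) sequentially"
    using h pos by (intro order_tendstoD(2)) (auto simp: s_def)
  then obtain N where N: "\<And>k. k \<ge> N \<Longrightarrow> h k < s / 2" by (auto simp: eventually_sequentially)
  \<comment> \<open>If no value equalled \<open>s\<close>, then \<open>m\<close> would be an upper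
    bound strictly below \<open>s\<close>.\<close>
  define m where "m = Max (insert (s / 2) (F ` {..<N}))"
  have "m < s" using lt pos by (auto simp: m_def s_def[symmetric])
  moreover have "F k \<le> m" for k
  proof (cases "k < N")
    case True
    then show ?thesis by (auto simp: m_def)
  next
    case False
    then have "F k \<le> s / 2" using N[of k] F[of k] by linarith
    also have "\<dots> \<le> m" unfolding m_def by (rule Max_ge) auto
    finally show ?thesis .
  qed
  then have "s \<le> m" unfolding s_def by (intro cSUP_least) auto
  ultimately show False by simp
qed

text \<open>A lower bound for the supremum near \<open>t\<close> comes from a single
  \<open>F k\<close>. For an upper bound, the common bound \<open>h\<close> makes all but finitely
  many functions uniformly small, which leaves a finite intersection of neighbourhoods.\<close>

lemma continuous_on_Sup_of_vanishing_bound: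
  fixes F :: "nat \<Rightarrow> 'a::topological_space \<Rightarrow> real"
  assumes F: "\<And>k t. 0 \<le> F k t" "\<And>k t. F k t \<le> h k" and h: "h \<longlonglongrightarrow> 0"
    and cont: "\<And>k. continuous_on UNIV (F k)"
  shows "continuous_on UNIV (\<lambda>t. SUP k. F k t)"
  unfolding continuous_on_def
proof (intro ballI order_tendstoI)
  fix t b
  obtain B where "\<And>k. h k \<le> B"
    using convergent_imp_Bseq[OF convergentI[OF h]] by (auto simp: Bseq_def abs_le_iff)
  then have bdd: "bdd_above (range (\<lambda>k. F k t))" for t using F by (meson bdd_above.I2 order_trans)
  have le: "F k t \<le> (SUP k. F k t)" for k t by (rule cSUP_upper[OF UNIV_I bdd])
  have tend: "(F k \<longlongrightarrow> F k t) (at t within UNIV)" for k using cont by (simp add: continuous_on_def)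
  show "\<forall>\<^sub>F x in at t within UNIV. b < (SUP k. F k x)" if b: "b < (SUP k. F k t)"
  proof -
    obtain k where "b < F k t" using b less_cSUP_iff[OF _ bdd] by auto
    then have "\<forall>\<^sub>F x in at t within UNIV. b < F k x" using tend order_tendstoD(1) by blast
    then show ?thesis by eventually_elim (use le less_le_trans in blast)
  qed
  show "\<forall>\<^sub>F x in at t within UNIV. (SUP k. F k x) < b" if b: "(SUP k. F k t) < b"
  proof -
    \<comment> \<open>The intermediate value \<open>c\<close> absorbs the loss of strictness in
      passing to the supremum; it is positive because the functions are non-negative.\<close>
    obtain c where c: "(SUP k. F k t) < c" "c < b" using b dense by blast
    have "0 < c" using c F(1)[of 0 t] le[of 0 t] by linarith
    then obtain N where N: "\<And>k. k \<ge> N \<Longrightarrow> h k < c"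
      using order_tendstoD(2)[OF h] by (auto simp: eventually_sequentially)
    have "\<forall>\<^sub>F x in at t within UNIV. \<forall>k\<in>{..<N}. F k x < c"
    proof (intro eventually_ball_finite ballI)
      fix k
      have "F k t < c" using le[of k t] c(1) by linarith
      then show "\<forall>\<^sub>F x in at t within UNIV. F k x < c" by (rule order_tendstoD(2)[OF tend])
    qed simp
    then show ?thesis
    proof eventually_elim
      case (elim x)
      have "F k x \<le> c" for k
        using elim N[of k] F(2)[of k x] by (cases "k < N") (auto intro: less_imp_le)
      then have "(SUP k. F k x) \<le> c" by (intro cSUP_least) auto
      then show ?case using c by simp
    qed
  qed
qed

section \<open>Power estimates, and the sequence of tents\<close>

lemma powr_diff_mean_value:
  fixes x y r :: real
  assumes "0 < x" "x < y"
  obtains \<xi> where "x < \<xi>" "\<xi> < y" "y powr r - x powr r = (y - x) * (r * \<xi> powr (r - 1))"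
proof -
  have "\<exists>z>x. z < y \<and> y powr r - x powr r = (y - x) * (r * z powr (r - 1))"
    by (rule MVT2[OF assms(2)]) (use assms in \<open>auto intro!: has_real_derivative_powr\<close>)
  then show thesis using that by blast
qed

text \<open>Comparison with the integral of \<open>x powr - a\<close>, carried out one step at a
  time by the mean value theorem.\<close>

lemma sum_powr_le:
  assumes a: "0 < a" "a < (1::real)"
  shows "(\<Sum>k<K. (real k + 1) powr - a) \<le> real K powr (1 - a) / (1 - a)"
proof (induction K)
  case (Suc K)
  have "(1 - a) * (real K + 1) powr - a \<le> (real K + 1) powr (1 - a) - real K powr (1 - a)"
  \<comment> \<open>The mean value theorem is available for a positive left end only, so the first
    step is checked directly.\<close>
  proof (cases "K = 0")
    case False
    then obtain \<xi> where \<xi>: "real K < \<xi>" "\<xi> < real K + 1"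
      "(real K + 1) powr (1 - a) - real K powr (1 - a) = (real K + 1 - real K) * ((1 - a) * \<xi> powr (1 - a - 1))"
      using powr_diff_mean_value[of "real K" "real K + 1" "1 - a"] by auto
    have "(real K + 1) powr - a \<le> \<xi> powr - a" using \<xi> a by (intro powr_mono2') auto
    then show ?thesis using \<xi>(3) a by (simp add: mult_left_mono)
  qed (use a in simp)
  then have "(real K + 1) powr - a \<le> ((real K + 1) powr (1 - a) - real K powr (1 - a)) / (1 - a)"
    using a by (simp add: pos_le_divide_eq mult.commute)
  then show ?case using Suc by (simp add: diff_divide_distrib add.commute)
qed simp

text \<open>The index is shifted so that \<open>node \<alpha> 0\<close> is \<open>1\<close>. For
  \<alpha> > 1 the nodes decrease to 0, with gaps of order \<open>k powr - \<alpha>\<close>.\<close>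

definition node :: "real \<Rightarrow> nat \<Rightarrow> real" where
  "node \<alpha> k = (real k + 1) powr (1 - \<alpha>)"

definition height :: "real \<Rightarrow> nat \<Rightarrow> real" where
  "height a k = (real k + 1) powr - a"

text \<open>The gap between nodes governs the dimension, the base of the tent governs the integral.
  Dividing by \<open>2 ^ k\<close> makes the bases summable to every positive power.\<close>

definition width :: "real \<Rightarrow> nat \<Rightarrow> real" where
  "width \<alpha> k = (node \<alpha> k - node \<alpha> (Suc k)) / 2 ^ k"

definition centre :: "real \<Rightarrow> nat \<Rightarrow> real" where
  "centre \<alpha> k = node \<alpha> (Suc k) + width \<alpha> k / 2"

definition tent :: "real \<Rightarrow> real \<Rightarrow> nat \<Rightarrow> real \<Rightarrow> real" where
  "tent \<alpha> a k t = height a k * max 0 (1 - 2 * \<bar>t - centre \<alpha> k\<bar> / width \<alpha> k)"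

text \<open>When \<alpha> > 1 the tents have disjoint supports up to endpoints, so this supremum is
  also their sum.\<close>

definition profile :: "real \<Rightarrow> real \<Rightarrow> real \<Rightarrow> real" where
  "profile \<alpha> a t = (SUP k. tent \<alpha> a k t)"

text \<open>With \<open>0 < a\<close> the heights tend to \<open>0\<close>, which makes the profile
  continuous; with \<open>a < 1\<close> their sum diverges, which raises the dimension.\<close>

locale spikes =
  fixes \<alpha> a :: real
  assumes \<alpha>: "1 < \<alpha>" and a: "0 < a" "a < 1"
begin

lemma node_pos: "0 < node \<alpha> k"
  by (simp add: node_def)

lemma node_less: "j < k \<Longrightarrow> node \<alpha> k < node \<alpha> j"
  unfolding node_def using \<alpha> by (intro powr_less_mono2_neg) auto

lemma node_antimono: "j \<le> k \<Longrightarrow> node \<alpha> k \<le> node \<alpha> j"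
  using node_less[of j k] by (cases "j = k") auto

lemma node_le_1: "node \<alpha> k \<le> 1"
  using node_antimono[of 0 k] by (simp add: node_def)

lemma node_gap_le: "node \<alpha> k - node \<alpha> (Suc k) \<le> (\<alpha> - 1) * (real k + 1) powr - \<alpha>"
proof -
  obtain \<xi> where \<xi>: "real k + 1 < \<xi>" "(real k + 2) powr (1 - \<alpha>) - (real k + 1) powr (1 - \<alpha>)
      = (real k + 2 - (real k + 1)) * ((1 - \<alpha>) * \<xi> powr (1 - \<alpha> - 1))"
    using powr_diff_mean_value[of "real k + 1" "real k + 2" "1 - \<alpha>"] by auto
  have "\<xi> powr - \<alpha> \<le> (real k + 1) powr - \<alpha>" using \<xi>(1) \<alpha> by (intro powr_mono2') auto
  then have "(\<alpha> - 1) * \<xi> powr - \<alpha> \<le> (\<alpha> - 1) * (real k + 1) powr - \<alpha>"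
    using \<alpha> by (intro mult_left_mono) auto
  then show ?thesis using \<xi>(2) by (simp add: node_def algebra_simps)
qed

lemma width_pos: "0 < width \<alpha> k"
  using node_less[of k "Suc k"] by (simp add: width_def)

lemma width_le_gap: "width \<alpha> k \<le> node \<alpha> k - node \<alpha> (Suc k)"
proof -
  have "(node \<alpha> k - node \<alpha> (Suc k)) * 1 \<le> (node \<alpha> k - node \<alpha> (Suc k)) * 2 ^ k"
    using node_less[of k "Suc k"] by (intro mult_left_mono) auto
  then show ?thesis by (simp add: width_def pos_divide_le_eq)
qed

lemma width_le_power: "width \<alpha> k \<le> (1/2) ^ k"
  using node_le_1[of k] node_pos[of "Suc k"]
  by (simp add: width_def power_one_over divide_simps)

lemma height_pos: "0 < height a k"
  by (simp add: height_def)

lemma height_antimono: "j \<le> k \<Longrightarrow> height a k \<le> height a j"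
  unfolding height_def using a by (intro powr_mono2') auto

lemma height_le_1: "height a k \<le> 1"
  using height_antimono[of 0 k] by (simp add: height_def)

lemma height_less_1: "0 < k \<Longrightarrow> height a k < 1"
  using powr_less_mono2_neg[of "- a" 1 "real k + 1"] a by (simp add: height_def)

text \<open>Geometric decay beats polynomial decay. The tents being no wider than tall, their sides
  can be parametrised by height with a Lipschitz constant independent of \<open>k\<close>.\<close>

lemma width_le_height: "width \<alpha> k \<le> height a k"
proof -
  have "width \<alpha> k \<le> (1/2) ^ k" by (rule width_le_power)
  also have "\<dots> \<le> (real k + 1) powr - 1"
  proof -
    have "real k + 1 \<le> 2 ^ k" by (induction k) auto
    then show ?thesis by (simp add: power_one_over powr_minus_divide divide_simps)
  qed
  also have "\<dots> \<le> height a k" unfolding height_def using a by (intro powr_mono) auto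
  finally show ?thesis .
qed

lemma height_tendsto_0: "height a \<longlonglongrightarrow> 0"
proof -
  have "((\<lambda>x::real. x powr - a) \<longlongrightarrow> 0) at_top" using a by (intro tendsto_neg_powr filterlim_ident) auto
  moreover have "filterlim (\<lambda>k. real k + 1) at_top sequentially"
    using filterlim_compose[OF filterlim_real_sequentially filterlim_Suc] by (simp add: add.commute)
  ultimately show ?thesis unfolding height_def[abs_def] by (rule filterlim_compose)
qed

lemma tent_nonneg: "0 \<le> tent \<alpha> a k t"
  using height_pos[of k] by (simp add: tent_def)

lemma tent_le: "tent \<alpha> a k t \<le> height a k"
proof -
  have "height a k * max 0 (1 - 2 * \<bar>t - centre \<alpha> k\<bar> / width \<alpha> k) \<le> height a k * 1"
    using height_pos[of k] width_pos[of k] by (intro mult_left_mono) auto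
  then show ?thesis by (simp add: tent_def)
qed

lemma tent_pos_iff: "0 < tent \<alpha> a k t \<longleftrightarrow> node \<alpha> (Suc k) < t \<and> t < node \<alpha> (Suc k) + width \<alpha> k"
proof -
  have "0 < tent \<alpha> a k t \<longleftrightarrow> 2 * \<bar>t - centre \<alpha> k\<bar> / width \<alpha> k < 1"
    using height_pos[of k] by (auto simp: tent_def zero_less_mult_iff)
  also have "\<dots> \<longleftrightarrow> 2 * \<bar>t - centre \<alpha> k\<bar> < width \<alpha> k" using width_pos[of k] by (simp add: pos_divide_less_eq)
  also have "\<dots> \<longleftrightarrow> node \<alpha> (Suc k) < t \<and> t < node \<alpha> (Suc k) + width \<alpha> k"
    unfolding centre_def by (auto simp: abs_if)
  finally show ?thesis .
qed

lemma tent_eq: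
  assumes "0 < tent \<alpha> a k t"
  shows "tent \<alpha> a k t = height a k * (1 - 2 * \<bar>t - centre \<alpha> k\<bar> / width \<alpha> k)"
  using assms by (auto simp: tent_def max_def split: if_splits)

lemma tent_centre: "tent \<alpha> a k (centre \<alpha> k) = height a k"
  by (simp add: tent_def)

lemma continuous_on_tent: "continuous_on UNIV (tent \<alpha> a k)"
  unfolding tent_def[abs_def] using width_pos[of k] by (intro continuous_intros) auto

lemma tent_le_1: "tent \<alpha> a k t \<le> 1"
  using tent_le[of k t] height_le_1[of k] by linarith

lemma tent_le_profile: "tent \<alpha> a k t \<le> profile \<alpha> a t"
  unfolding profile_def using tent_le_1 by (intro cSUP_upper bdd_above.I2[of _ _ 1]) auto

lemma profile_nonneg: "0 \<le> profile \<alpha> a t"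
  using tent_le_profile[of 0 t] tent_nonneg[of 0 t] by linarith

lemma profile_le_1: "profile \<alpha> a t \<le> 1"
  unfolding profile_def using tent_le_1 by (intro cSUP_least) auto

lemma continuous_on_profile: "continuous_on UNIV (profile \<alpha> a)"
  unfolding profile_def[abs_def]
  by (rule continuous_on_Sup_of_vanishing_bound[OF tent_nonneg tent_le height_tendsto_0 continuous_on_tent])

lemma profile_attained:
  assumes "0 < profile \<alpha> a t"
  obtains k where "profile \<alpha> a t = tent \<alpha> a k t"
  using Sup_attained_of_vanishing_bound[OF tent_le height_tendsto_0 assms[unfolded profile_def]] that
  unfolding profile_def by blast

text \<open>A tent is positive only strictly between consecutive nodes. The zeros at the nodes serve
  as left ends for the intermediate value theorem.\<close>

lemma profile_node: "profile \<alpha> a (node \<alpha> k) = 0"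
proof (rule ccontr)
  assume "profile \<alpha> a (node \<alpha> k) \<noteq> 0"
  then have "0 < profile \<alpha> a (node \<alpha> k)" using profile_nonneg[of "node \<alpha> k"] by simp
  moreover from this obtain j where "profile \<alpha> a (node \<alpha> k) = tent \<alpha> a j (node \<alpha> k)"
    by (rule profile_attained)
  ultimately have "0 < tent \<alpha> a j (node \<alpha> k)" by simp
  then have j: "node \<alpha> (Suc j) < node \<alpha> k" "node \<alpha> k < node \<alpha> j"
    using width_le_gap[of j] by (auto simp: tent_pos_iff)
  then have "k < Suc j" "j < k" using node_antimono by (meson not_le)+
  then show False by simp
qed

text \<open>Only the tent of index 0 reaches height 1. The location of this peak is what later
  recovers \<alpha> from the surface.\<close>

lemma profile_eq_1_iff: "profile \<alpha> a t = 1 \<longleftrightarrow> t = centre \<alpha> 0"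
proof
  assume 1: "profile \<alpha> a t = 1"
  then have "0 < profile \<alpha> a t" by simp
  then obtain k where "profile \<alpha> a t = tent \<alpha> a k t" by (rule profile_attained)
  then have k: "tent \<alpha> a k t = 1" using 1 by simp
  then have "k = 0" using tent_le[of k t] height_less_1[of k] by (cases "k = 0") auto
  then show "t = centre \<alpha> 0"
    using k tent_eq[of 0 t] width_pos[of 0] by (simp add: height_def)
next
  assume "t = centre \<alpha> 0"
  then have "1 \<le> profile \<alpha> a t" using tent_centre[of 0] tent_le_profile[of 0 t] by (simp add: height_def)
  then show "profile \<alpha> a t = 1" using profile_le_1[of t] by simp
qed

text \<open>Every gap in this range contains a tent at least as high as
  \<open>height a (2 * K + 1)\<close>, so each level \<open>u\<close> is reached in the gap
  containing \<open>t\<close>. The distance is then at most the length of that gap.\<close>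

lemma profile_attains_near:
  assumes t: "node \<alpha> (2 * K + 1) \<le> t" "t \<le> node \<alpha> K" and u: "0 \<le> u" "u \<le> height a (2 * K + 1)"
  obtains t' where "0 \<le> t'" "t' \<le> 1" "\<bar>t - t'\<bar> \<le> \<alpha> * (real K + 1) powr - \<alpha>" "profile \<alpha> a t' = u"
proof -
  \<comment> \<open>The least such index locates the gap from \<open>node \<alpha> (Suc k)\<close>
    to \<open>node \<alpha> k\<close> that contains \<open>t\<close>.\<close>
  define k where "k = (LEAST k. node \<alpha> (Suc k) \<le> t)"
  have t2: "node \<alpha> (Suc (2 * K)) \<le> t" using t by simp
  have k1: "node \<alpha> (Suc k) \<le> t"
    using LeastI[where P = "\<lambda>k. node \<alpha> (Suc k) \<le> t", OF t2] unfolding k_def .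
  have k2: "k \<le> 2 * K"
    using Least_le[where P = "\<lambda>k. node \<alpha> (Suc k) \<le> t", OF t2] unfolding k_def .
  have k3: "t \<le> node \<alpha> k \<and> K \<le> k \<or> t = node \<alpha> K"
  proof (cases "k \<le> K")
    case True
    have "t = node \<alpha> K \<or> K \<le> k"
    proof (rule disjCI)
      assume "\<not> K \<le> k"
      then have "node \<alpha> K \<le> node \<alpha> (Suc k)" by (intro node_antimono) auto
      then show "t = node \<alpha> K" using k1 t by linarith
    qed
    then show ?thesis using True t by auto
  next
    case False
    then obtain j where j: "k = Suc j" by (cases k) auto
    have "\<not> node \<alpha> (Suc j) \<le> t" using j unfolding k_def using not_less_Least[of j "\<lambda>k. node \<alpha> (Suc k) \<le> t"] by simp
    then show ?thesis using j False by auto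
  qed
  \<comment> \<open>At \<open>t = node \<alpha> K\<close> the least index can be
    \<open>K - 1\<close>; the neighbouring gap with index \<open>K\<close> is taken instead.\<close>
  obtain k where k: "K \<le> k" "k \<le> 2 * K" "node \<alpha> (Suc k) \<le> t" "t \<le> node \<alpha> k"
  proof (cases "t = node \<alpha> K")
    case True
    then show thesis using that[of K] node_antimono[of K "Suc K"] by auto
  next
    case False
    then show thesis using that[of k] k1 k2 k3 by auto
  qed
  have c: "node \<alpha> (Suc k) \<le> centre \<alpha> k" "centre \<alpha> k \<le> node \<alpha> k"
    using width_pos[of k] width_le_gap[of k] by (auto simp: centre_def)
  have "u \<le> height a k" using u(2) height_antimono[of k "2 * K + 1"] k(2) by simp
  also have "\<dots> \<le> profile \<alpha> a (centre \<alpha> k)" using tent_le_profile[of k "centre \<alpha> k"] tent_centre by simp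
  \<comment> \<open>The profile is \<open>0\<close> at the left node and at least \<open>u\<close>
    at the centre of the tent.\<close>
  finally have "\<exists>t'\<ge>node \<alpha> (Suc k). t' \<le> centre \<alpha> k \<and> profile \<alpha> a t' = u"
    using c u(1) profile_node continuous_on_profile
    by (intro IVT') (auto intro: continuous_on_subset)
  then obtain t' where t': "node \<alpha> (Suc k) \<le> t'" "t' \<le> centre \<alpha> k" "profile \<alpha> a t' = u" by blast
  have "\<bar>t - t'\<bar> \<le> node \<alpha> k - node \<alpha> (Suc k)" using t' k c by (simp add: abs_le_iff)
  also have "\<dots> \<le> (\<alpha> - 1) * (real k + 1) powr - \<alpha>" by (rule node_gap_le)
  also have "\<dots> \<le> \<alpha> * (real K + 1) powr - \<alpha>"
    using \<alpha> k(1) by (intro mult_mono powr_mono2') auto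
  finally show thesis
  proof (rule that[rotated 2])
    show "0 \<le> t'" using t'(1) node_pos[of "Suc k"] by linarith
    show "t' \<le> 1" using t'(2) c(2) node_le_1[of k] by linarith
    show "profile \<alpha> a t' = u" by fact
  qed
qed

end

section \<open>The spiked cube\<close>

locale spiked_cube = spikes +
  fixes i\<^sub>0 i\<^sub>1 :: "'m::finite"
  assumes i01: "i\<^sub>0 \<noteq> i\<^sub>1"
begin

abbreviation g :: "real \<Rightarrow> real" where "g \<equiv> profile \<alpha> a"

definition surface :: "(real ^ 'm) set" where
  "surface = stretch i\<^sub>0 i\<^sub>1 g ` frontier (box (-1) 1)"

lemma card_index_ge_2: "2 \<le> CARD('m)"
  using card_mono[of UNIV "{i\<^sub>0, i\<^sub>1}"] i01 by simp

lemmas stretch_homeomorphism = homeomorphism_stretch[OF i01 continuous_on_profile profile_nonneg]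

lemma unit_box: "open (box (-1) (1::real^'m))" "convex (box (-1) (1::real^'m))"
  "bounded (box (-1) (1::real^'m))" "box (-1) (1::real^'m) \<noteq> {}"
proof -
  have "0 \<in> box (-1) (1::real^'m)" by (simp add: mem_box_cart)
  then show "box (-1) (1::real^'m) \<noteq> {}" by blast
qed (auto simp: open_box convex_box bounded_box)

text \<open>The surface is the image of the closed cube minus the image of the open one, and both
  images are described by inequalities.\<close>

lemma mem_surface_iff:
  "x \<in> surface \<longleftrightarrow> (\<forall>i. i \<noteq> i\<^sub>0 \<longrightarrow> \<bar>x $ i\<bar> \<le> 1) \<and> \<bar>x $ i\<^sub>0\<bar> \<le> 1 + g (x $ i\<^sub>1) \<and>
     \<not> ((\<forall>i. i \<noteq> i\<^sub>0 \<longrightarrow> \<bar>x $ i\<bar> < 1) \<and> \<bar>x $ i\<^sub>0\<bar> < 1 + g (x $ i\<^sub>1))"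
proof -
  have "surface = stretch i\<^sub>0 i\<^sub>1 g ` cbox (-1) 1 - stretch i\<^sub>0 i\<^sub>1 g ` box (-1) 1"
    unfolding surface_def frontier_open_convex_image[OF stretch_homeomorphism unit_box]
    using closure_box[OF unit_box(4)] by simp
  then show ?thesis unfolding stretch_box[OF i01 profile_nonneg] by auto
qed

lemma inside_surface:
  "inside surface = {x. (\<forall>i. i \<noteq> i\<^sub>0 \<longrightarrow> \<bar>x $ i\<bar> < 1) \<and> \<bar>x $ i\<^sub>0\<bar> < 1 + g (x $ i\<^sub>1)}"
proof -
  have "inside surface = stretch i\<^sub>0 i\<^sub>1 g ` box (-1) 1"
    unfolding surface_def
    using card_index_ge_2 by (intro homeomorphic_convex_image_inside[OF stretch_homeomorphism unit_box]) simp
  then show ?thesis unfolding stretch_box(1)[OF i01 profile_nonneg] .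
qed

lemma boundary_of_Jordan_domain_surface: "boundary_of_Jordan_domain surface"
  unfolding surface_def
  using card_index_ge_2 by (intro homeomorphic_convex_image_inside[OF stretch_homeomorphism unit_box]) simp

lemma compact_topological_hypersurface_surface:
  assumes "CARD('m) = n + 1"
  shows "compact_topological_hypersurface n surface"
  unfolding surface_def
  using card_index_ge_2 assms by (intro homeomorphic_convex_image_hypersurface[OF stretch_homeomorphism unit_box]) auto

section \<open>Convex pieces of the interior and the Marcinkiewicz exponent\<close>

definition spike :: "nat \<Rightarrow> (real ^ 'm) set" where
  "spike k = {x. (\<forall>i. i \<noteq> i\<^sub>0 \<longrightarrow> \<bar>x $ i\<bar> < 1) \<and> \<bar>x $ i\<^sub>1 - centre \<alpha> k\<bar> < width \<alpha> k / 2 \<and>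
     \<bar>x $ i\<^sub>0\<bar> + height a k * (2 * \<bar>x $ i\<^sub>1 - centre \<alpha> k\<bar> / width \<alpha> k) < 1 + height a k}"

text \<open>The piece runs through the full height of the cube and ends in a roof at the top and a
  mirrored one at the bottom. It is thus cut out by strict upper bounds on convex functions.\<close>

lemma convex_spike: "convex (spike k)"
proof (rule convexI)
  fix x y :: "real ^ 'm" and u v :: real
  assume x: "x \<in> spike k" and y: "y \<in> spike k" and uv: "0 \<le> u" "0 \<le> v" "u + v = 1"
  \<comment> \<open>The slope of the roof.\<close>
  define q where "q = height a k * 2 / width \<alpha> k"
  have q: "0 \<le> q" using height_pos[of k] width_pos[of k] by (simp add: q_def)
  have comb: "u * s + v * t < B" if "s < B" "t < B" for s t B
    using convex_bound_lt[OF that uv] .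
  have tri: "\<bar>u * s + v * t - c\<bar> \<le> u * \<bar>s - c\<bar> + v * \<bar>t - c\<bar>" for s t c
  proof -
    have "u * s + v * t - c = u * (s - c) + v * (t - c) + (u + v - 1) * c" by (simp add: algebra_simps)
    then have "u * s + v * t - c = u * (s - c) + v * (t - c)" using uv(3) by simp
    then show ?thesis using abs_triangle_ineq[of "u * (s - c)" "v * (t - c)"] uv by (simp add: abs_mult)
  qed
  have tri0: "\<bar>u * s + v * t\<bar> \<le> u * \<bar>s\<bar> + v * \<bar>t\<bar>" for s t using tri[of s t 0] by simp
  let ?z = "u *\<^sub>R x + v *\<^sub>R y"
  have x': "\<bar>x $ i\<^sub>0\<bar> + q * \<bar>x $ i\<^sub>1 - centre \<alpha> k\<bar> < 1 + height a k"
    and y': "\<bar>y $ i\<^sub>0\<bar> + q * \<bar>y $ i\<^sub>1 - centre \<alpha> k\<bar> < 1 + height a k"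
    using x y by (simp_all add: spike_def q_def)
  have "\<bar>?z $ i\<^sub>0\<bar> + q * \<bar>?z $ i\<^sub>1 - centre \<alpha> k\<bar>
      \<le> (u * \<bar>x $ i\<^sub>0\<bar> + v * \<bar>y $ i\<^sub>0\<bar>) + q * (u * \<bar>x $ i\<^sub>1 - centre \<alpha> k\<bar> + v * \<bar>y $ i\<^sub>1 - centre \<alpha> k\<bar>)"
    using tri0 tri q by (intro add_mono mult_left_mono) auto
  also have "\<dots> = u * (\<bar>x $ i\<^sub>0\<bar> + q * \<bar>x $ i\<^sub>1 - centre \<alpha> k\<bar>) + v * (\<bar>y $ i\<^sub>0\<bar> + q * \<bar>y $ i\<^sub>1 - centre \<alpha> k\<bar>)"
    by (simp add: algebra_simps)
  also have "\<dots> < 1 + height a k" by (rule comb[OF x' y'])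
  finally have 1: "\<bar>?z $ i\<^sub>0\<bar> + q * \<bar>?z $ i\<^sub>1 - centre \<alpha> k\<bar> < 1 + height a k" .
  have 2: "\<bar>?z $ i\<^sub>1 - centre \<alpha> k\<bar> < width \<alpha> k / 2"
  proof -
    have "u * \<bar>x $ i\<^sub>1 - centre \<alpha> k\<bar> + v * \<bar>y $ i\<^sub>1 - centre \<alpha> k\<bar> < width \<alpha> k / 2"
      using x y by (intro comb) (auto simp: spike_def)
    then show ?thesis using tri[of "x $ i\<^sub>1" "y $ i\<^sub>1" "centre \<alpha> k"] by simp
  qed
  have 3: "\<bar>?z $ i\<bar> < 1" if "i \<noteq> i\<^sub>0" for i
  proof -
    have "u * \<bar>x $ i\<bar> + v * \<bar>y $ i\<bar> < 1"
      using x y that by (intro comb) (auto simp: spike_def)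
    then show ?thesis using tri0[of "x $ i" "y $ i"] by simp
  qed
  show "?z \<in> spike k" unfolding spike_def mem_Collect_eq using 1 2 3 by (simp add: q_def)
qed

lemma open_spike: "open (spike k)"
proof -
  have "spike k = (\<Inter>i\<in>UNIV - {i\<^sub>0}. {x. \<bar>x $ i\<bar> < 1}) \<inter> {x. \<bar>x $ i\<^sub>1 - centre \<alpha> k\<bar> < width \<alpha> k / 2} \<inter>
    {x. \<bar>x $ i\<^sub>0\<bar> + height a k * (2 * \<bar>x $ i\<^sub>1 - centre \<alpha> k\<bar> / width \<alpha> k) < 1 + height a k}"
    by (auto simp: spike_def)
  moreover have "width \<alpha> k \<noteq> 0" using width_pos[of k] by simp
  ultimately show ?thesis
    by (simp only:) (intro open_Int open_INT finite_Diff finite ballI open_Collect_less continuous_intros; simp)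
qed

text \<open>The ball is placed in the middle of the cube and not in the narrow tip, so its radius
  can be the full half-width of the piece.\<close>

lemma ball_subset_spike: "ball (axis i\<^sub>1 (centre \<alpha> k)) (width \<alpha> k / 2) \<subseteq> spike k"
proof
  fix x assume "x \<in> ball (axis i\<^sub>1 (centre \<alpha> k)) (width \<alpha> k / 2)"
  then have "norm (x - axis i\<^sub>1 (centre \<alpha> k)) < width \<alpha> k / 2"
    by (simp add: dist_norm norm_minus_commute)
  then have *: "\<bar>x $ i - axis i\<^sub>1 (centre \<alpha> k) $ i\<bar> < width \<alpha> k / 2" for i
    using component_le_norm_cart[of "x - axis i\<^sub>1 (centre \<alpha> k)" i] by simp
  have w: "width \<alpha> k \<le> 1" "0 < width \<alpha> k" "width \<alpha> k \<le> node \<alpha> k - node \<alpha> (Suc k)"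
    using width_le_height[of k] height_le_1[of k] width_pos[of k] width_le_gap[of k] by linarith+
  have 1: "\<bar>x $ i\<^sub>1 - centre \<alpha> k\<bar> < width \<alpha> k / 2" using *[of i\<^sub>1] by (simp add: axis_def)
  have 2: "\<bar>x $ i\<bar> < 1 / 2" if "i \<noteq> i\<^sub>1" for i using *[of i] that w by (simp add: axis_def)
  have 3: "\<bar>x $ i\<^sub>1\<bar> < 1"
    using 1 w node_pos[of "Suc k"] node_le_1[of k] unfolding centre_def by linarith
  have "height a k * (2 * \<bar>x $ i\<^sub>1 - centre \<alpha> k\<bar> / width \<alpha> k) \<le> height a k * 1"
    using 1 w height_pos[of k] by (intro mult_left_mono) auto
  then have 4: "\<bar>x $ i\<^sub>0\<bar> + height a k * (2 * \<bar>x $ i\<^sub>1 - centre \<alpha> k\<bar> / width \<alpha> k) < 1 + height a k"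
    using 2[of i\<^sub>0] i01 by simp
  have 5: "\<bar>x $ i\<bar> < 1" if "i \<noteq> i\<^sub>0" for i using 2[of i] 3 by (cases "i = i\<^sub>1") auto
  show "x \<in> spike k" unfolding spike_def using 1 4 5 by simp
qed

lemma measure_spike: "bounded (spike k)" "measure lebesgue (spike k) \<le> width \<alpha> k * 4 ^ CARD('m)"
proof -
  define l u :: "real ^ 'm" where "l = (\<chi> i. if i = i\<^sub>1 then centre \<alpha> k - width \<alpha> k / 2 else - 2)"
    and "u = (\<chi> i. if i = i\<^sub>1 then centre \<alpha> k + width \<alpha> k / 2 else 2)"
  have lu: "l $ i \<le> u $ i" for i using width_pos[of k] by (simp add: l_def u_def)
  have sub: "spike k \<subseteq> cbox l u"
  proof
    fix x assume x: "x \<in> spike k"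
    have "0 \<le> height a k * (2 * \<bar>x $ i\<^sub>1 - centre \<alpha> k\<bar> / width \<alpha> k)"
      using height_pos[of k] width_pos[of k] by simp
    then have "\<bar>x $ i\<^sub>0\<bar> < 2" using x height_le_1[of k] unfolding spike_def mem_Collect_eq by linarith
    then have "\<bar>x $ i\<bar> < 2" for i using x by (cases "i = i\<^sub>0") (fastforce simp: spike_def)+
    moreover have "\<bar>x $ i\<^sub>1 - centre \<alpha> k\<bar> < width \<alpha> k / 2" using x by (simp add: spike_def)
    then have "centre \<alpha> k - width \<alpha> k / 2 \<le> x $ i\<^sub>1" "x $ i\<^sub>1 \<le> centre \<alpha> k + width \<alpha> k / 2"
      by linarith+
    ultimately have "l $ i \<le> x $ i \<and> x $ i \<le> u $ i" for i
      by (cases "i = i\<^sub>1") (auto simp: l_def u_def abs_less_iff less_imp_le minus_le_iff)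
    then show "x \<in> cbox l u" by (simp add: mem_box_cart)
  qed
  show "bounded (spike k)" by (rule bounded_subset[OF bounded_cbox sub])
  have "measure lebesgue (spike k) \<le> measure lebesgue (cbox l u)"
    by (rule measure_mono_fmeasurable[OF sub]) (auto simp: open_spike intro: borel_open)
  also have "\<dots> = (\<Prod>i\<in>UNIV. u $ i - l $ i)"
    using lu by (simp add: content_cbox_cart interval_eq_empty_cart not_less)
  also have "\<dots> = width \<alpha> k * (\<Prod>i\<in>UNIV - {i\<^sub>1}. 4)"
    by (subst prod.remove[of _ i\<^sub>1]) (auto simp: l_def u_def)
  also have "\<dots> \<le> width \<alpha> k * 4 ^ CARD('m)"
    using width_pos[of k] by (intro mult_left_mono) (auto simp: card_Diff_singleton intro: power_increasing)
  finally show "measure lebesgue (spike k) \<le> width \<alpha> k * 4 ^ CARD('m)" .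
qed

lemma spike_subset_inside: "spike k \<subseteq> inside surface"
proof
  fix x assume x: "x \<in> spike k"
  have "\<bar>x $ i\<^sub>0\<bar> < 1 + height a k * (1 - 2 * \<bar>x $ i\<^sub>1 - centre \<alpha> k\<bar> / width \<alpha> k)"
    using x by (simp add: spike_def algebra_simps)
  also have "\<dots> \<le> 1 + tent \<alpha> a k (x $ i\<^sub>1)"
    unfolding tent_def using height_pos[of k] by (intro add_left_mono mult_left_mono) auto
  also have "\<dots> \<le> 1 + g (x $ i\<^sub>1)" using tent_le_profile by simp
  finally show "x \<in> inside surface" using x by (simp add: inside_surface spike_def)
qed

text \<open>Where the profile vanishes the point lies in the cube; where it is positive it equals a
  single tent, whose index selects the spike.\<close>

lemma inside_surface_eq_Un_spikes: "inside surface = box (-1) 1 \<union> (\<Union>k. spike k)"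
proof
  have "box (-1) 1 \<subseteq> inside surface"
  proof
    fix x :: "real ^ 'm" assume "x \<in> box (-1) 1"
    then have "\<bar>x $ i\<bar> < 1" for i by (auto simp: mem_box_cart abs_less_iff minus_less_iff)
    then show "x \<in> inside surface"
      unfolding inside_surface using profile_nonneg[of "x $ i\<^sub>1"] by (smt (verit) mem_Collect_eq)
  qed
  then show "box (-1) 1 \<union> (\<Union>k. spike k) \<subseteq> inside surface" using spike_subset_inside by blast
  show "inside surface \<subseteq> box (-1) 1 \<union> (\<Union>k. spike k)"
  proof
    fix x assume "x \<in> inside surface"
    then have x: "\<And>i. i \<noteq> i\<^sub>0 \<Longrightarrow> \<bar>x $ i\<bar> < 1" "\<bar>x $ i\<^sub>0\<bar> < 1 + g (x $ i\<^sub>1)"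
      by (auto simp: inside_surface)
    show "x \<in> box (-1) 1 \<union> (\<Union>k. spike k)"
    proof (cases "g (x $ i\<^sub>1) = 0")
      case True
      then have "\<bar>x $ i\<bar> < 1" for i using x by (cases "i = i\<^sub>0") auto
      then have "x \<in> box (-1) 1" by (auto simp: mem_box_cart abs_less_iff minus_less_iff)
      then show ?thesis by blast
    next
      case False
      then have gp: "0 < g (x $ i\<^sub>1)" using profile_nonneg[of "x $ i\<^sub>1"] by simp
      then obtain k where k: "g (x $ i\<^sub>1) = tent \<alpha> a k (x $ i\<^sub>1)" by (rule profile_attained)
      then have p: "0 < tent \<alpha> a k (x $ i\<^sub>1)" using gp by simp
      have "\<bar>x $ i\<^sub>1 - centre \<alpha> k\<bar> < width \<alpha> k / 2"
        using p unfolding tent_pos_iff centre_def by (auto simp: abs_if)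
      moreover have "\<bar>x $ i\<^sub>0\<bar> + height a k * (2 * \<bar>x $ i\<^sub>1 - centre \<alpha> k\<bar> / width \<alpha> k) < 1 + height a k"
        using x(2) unfolding k tent_eq[OF p] by (simp add: algebra_simps)
      ultimately have "x \<in> spike k" using x(1) by (simp add: spike_def)
      then show ?thesis by blast
    qed
  qed
qed

lemma surface_nonempty: "surface \<noteq> {}"
proof -
  have "(\<chi> i. if i = i\<^sub>0 then 1 + g 1 else 1) \<in> surface"
    unfolding mem_surface_iff using i01 profile_nonneg[of 1] by simp
  then show ?thesis by blast
qed

text \<open>Volume and inradius of the \<open>k\<close>-th spike are both governed by its width, so
  its contribution is of order \<open>width \<alpha> k powr (1 - p)\<close>. The widths decay
  geometrically, so these sum up; the cube adds one finite term.\<close>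

lemma Marcinkiewicz_integral_inside_surface:
  assumes p: "0 < p" "p < 1"
  shows "Marcinkiewicz_integral surface p (inside surface) < \<infinity>"
proof -
  define M where "M = 1 + CARD('m) * 2 powr p / (1 - 2 powr (p - 1))"
  have q1: "2 powr (p - 1) < 1" using p powr_less_mono[of "p - 1" 0 2] by simp
  have M: "0 < M" using q1 p by (auto simp: M_def intro!: add_pos_nonneg)
  have disj: "surface \<inter> inside surface = {}" using inside_no_overlap[of surface] by blast
  have integral: "Marcinkiewicz_integral surface p K \<le> ennreal (M * (measure lebesgue K * r powr - p))"
    if K: "open K" "convex K" "bounded K" "ball c r \<subseteq> K" "0 < r" "K \<subseteq> inside surface"
    for K :: "(real ^ 'm) set" and c r
    using Marcinkiewicz_integral_convex[OF K(1-5) surface_nonempty _ p] K(6) disj by (auto simp: M_def)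
  have spike: "Marcinkiewicz_integral surface p (spike k)
      \<le> ennreal (M * (4 ^ CARD('m) * 2 powr p) * ((1/2) powr (1 - p)) ^ k)" for k
  proof -
    have "Marcinkiewicz_integral surface p (spike k)
       \<le> ennreal (M * (measure lebesgue (spike k) * (width \<alpha> k / 2) powr - p))"
      using width_pos[of k]
      by (intro integral[OF open_spike convex_spike measure_spike(1) ball_subset_spike _ spike_subset_inside]) simp
    also have "\<dots> \<le> ennreal (M * (4 ^ CARD('m) * 2 powr p) * ((1/2) powr (1 - p)) ^ k)"
    proof (rule ennreal_leI)
      have "measure lebesgue (spike k) * (width \<alpha> k / 2) powr - p
          \<le> width \<alpha> k * 4 ^ CARD('m) * (width \<alpha> k / 2) powr - p"
        using measure_spike(2) by (intro mult_right_mono) auto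
      also have "\<dots> = 4 ^ CARD('m) * 2 powr p * width \<alpha> k powr (1 - p)"
        using width_pos[of k] by (simp add: powr_divide powr_minus powr_diff divide_simps)
      also have "\<dots> \<le> 4 ^ CARD('m) * 2 powr p * ((1/2) ^ k) powr (1 - p)"
        using width_pos[of k] width_le_power[of k] p by (intro mult_left_mono powr_mono2) auto
      also have "((1/2::real) ^ k) powr (1 - p) = ((1/2) powr (1 - p)) ^ k"
        by (simp add: powr_powr mult.commute flip: powr_realpow)
      finally show "M * (measure lebesgue (spike k) * (width \<alpha> k / 2) powr - p)
          \<le> M * (4 ^ CARD('m) * 2 powr p) * ((1/2) powr (1 - p)) ^ k"
        using M by (simp add: mult.assoc)
    qed
    finally show ?thesis .
  qed
  \<comment> \<open>The ratio of the series over the spikes is below 1 because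
    \<open>p < 1\<close>.\<close>
  have half: "(1/2::real) powr (1 - p) < 1" using powr_less_mono2[of "1 - p" "1/2" 1] p by simp
  have "Marcinkiewicz_integral surface p (\<Union>k. spike k) \<le> suminf (\<lambda>k. Marcinkiewicz_integral surface p (spike k))"
    by (rule Marcinkiewicz_integral_UN) (simp add: open_spike)
  also have "\<dots> \<le> suminf (\<lambda>k. ennreal (M * (4 ^ CARD('m) * 2 powr p) * ((1/2) powr (1 - p)) ^ k))"
    by (intro suminf_le spike) auto
  also have "\<dots> = ennreal (suminf (\<lambda>k. M * (4 ^ CARD('m) * 2 powr p) * ((1/2) powr (1 - p)) ^ k))"
    using M half by (intro suminf_ennreal2 summable_mult summable_geometric) auto
  finally have spikes: "Marcinkiewicz_integral surface p (\<Union>k. spike k) < \<infinity>"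
    using ennreal_less_top le_less_trans by (metis infinity_ennreal_def)
  have "ball 0 1 \<subseteq> box (-1) (1::real^'m)"
  proof
    fix x :: "real ^ 'm" assume "x \<in> ball 0 1"
    then have "\<bar>x $ i\<bar> < 1" for i using component_le_norm_cart[of x i] by (simp add: le_less_trans)
    then show "x \<in> box (-1) 1" by (auto simp: mem_box_cart abs_less_iff minus_less_iff)
  qed
  moreover have "box (-1) 1 \<subseteq> inside surface" using inside_surface_eq_Un_spikes by blast
  ultimately have "Marcinkiewicz_integral surface p (box (-1) 1)
      \<le> ennreal (M * (measure lebesgue (box (-1) (1::real^'m)) * 1 powr - p))"
    using unit_box by (intro integral[where c = 0]) auto
  then have cube: "Marcinkiewicz_integral surface p (box (-1) 1) < \<infinity>"
    using ennreal_less_top le_less_trans by (metis infinity_ennreal_def)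
  have [measurable]: "box (-1) (1::real^'m) \<in> sets borel" "(\<Union>k. spike k) \<in> sets borel"
    using open_spike by auto
  have [measurable]: "(\<lambda>x. infdist x surface) \<in> borel_measurable borel"
    by (intro borel_measurable_continuous_onI continuous_intros)
  have "Marcinkiewicz_integral surface p (inside surface)
      \<le> (\<integral>\<^sup>+x. ennreal (1 / infdist x surface powr p) * indicator (box (-1) 1) x
          + ennreal (1 / infdist x surface powr p) * indicator (\<Union>k. spike k) x \<partial>lborel)"
    unfolding Marcinkiewicz_integral_def inside_surface_eq_Un_spikes
    by (intro nn_integral_mono) (simp add: indicator_def)
  also have "\<dots> = Marcinkiewicz_integral surface p (box (-1) 1) + Marcinkiewicz_integral surface p (\<Union>k. spike k)"
    unfolding Marcinkiewicz_integral_def by (intro nn_integral_add) measurable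
  also have "\<dots> < \<infinity>" using cube spikes by (simp add: ennreal_add_less_top)
  finally show ?thesis .
qed

text \<open>Every \<open>p\<close> between 0 and 1 is admissible on the inside, and the maximum
  dominates the interior exponent for every \<open>r\<close>.\<close>

lemma Marcinkiewicz_exponent_surface: "1 \<le> Marcinkiewicz_exponent r surface"
proof (rule dense_le_bounded)
  show "(0::ereal) < 1" by simp
  fix w :: ereal assume "0 < w" "w < 1"
  then obtain p where p: "w = ereal p" "0 < p" "p < 1" by (cases w) auto
  then have "w \<le> Marcinkiewicz_exponent_plus surface"
    unfolding Marcinkiewicz_exponent_plus_def
    using Marcinkiewicz_integral_inside_surface[OF p(2,3)] by (intro Sup_upper) auto
  then show "w \<le> Marcinkiewicz_exponent r surface"
    unfolding Marcinkiewicz_exponent_def by (rule max.coboundedI1)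
qed

section \<open>Lower bound for the covering numbers\<close>

lemma abs_nth_surface_le_2:
  assumes "x \<in> surface"
  shows "\<bar>x $ i\<bar> \<le> 2"
proof (cases "i = i\<^sub>0")
  case True
  then have "\<bar>x $ i\<bar> \<le> 1 + g (x $ i\<^sub>1)" using assms by (simp add: mem_surface_iff)
  then show ?thesis using profile_le_1[of "x $ i\<^sub>1"] by linarith
next
  case False
  then have "\<bar>x $ i\<bar> \<le> 1" using assms by (simp add: mem_surface_iff)
  then show ?thesis by linarith
qed

lemma coverable_surface:
  assumes "0 < \<delta>"
  obtains c where "coverable \<delta> surface c"
proof -
  have sub: "surface \<subseteq> cbox (\<chi> i. - 2) (\<chi> i. 2)"
    using abs_nth_surface_le_2 by (auto simp: mem_box_cart abs_le_iff minus_le_iff)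
  show thesis
    by (rule that[OF coverable_mono[OF coverable_cbox[OF assms] sub order_refl order_refl]]) simp
qed

text \<open>Only the coordinate \<open>i\<^sub>1\<close> is moved, to a place where the profile
  equals the height of \<open>x\<close> above the cube.\<close>

lemma near_surface:
  assumes R: "node \<alpha> (2 * K + 1) \<le> x $ i\<^sub>1" "x $ i\<^sub>1 \<le> node \<alpha> K"
    "1 \<le> x $ i\<^sub>0" "x $ i\<^sub>0 \<le> 1 + height a (2 * K + 1)"
    "\<And>i. i \<noteq> i\<^sub>0 \<Longrightarrow> i \<noteq> i\<^sub>1 \<Longrightarrow> \<bar>x $ i\<bar> \<le> 1"
  shows "\<exists>z\<in>surface. dist x z \<le> \<alpha> * (real K + 1) powr - \<alpha>"
proof -
  obtain t where t: "0 \<le> t" "t \<le> 1" "\<bar>x $ i\<^sub>1 - t\<bar> \<le> \<alpha> * (real K + 1) powr - \<alpha>" "g t = x $ i\<^sub>0 - 1"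
    by (rule profile_attains_near[of K "x $ i\<^sub>1" "x $ i\<^sub>0 - 1"]) (use R in auto)
  define z where "z = (\<chi> i. if i = i\<^sub>1 then t else x $ i)"
  have "z \<in> surface"
    unfolding mem_surface_iff using t R i01 by (auto simp: z_def)
  moreover have "dist x z \<le> \<bar>x $ i\<^sub>1 - t\<bar>"
  proof -
    have "norm (x - z) \<le> (\<Sum>i\<in>UNIV. \<bar>(x - z) $ i\<bar>)" by (rule norm_le_l1_cart)
    also have "\<dots> = (\<Sum>i\<in>UNIV. if i = i\<^sub>1 then \<bar>x $ i\<^sub>1 - t\<bar> else 0)"
      by (intro sum.cong) (auto simp: z_def)
    finally show ?thesis by (simp add: dist_norm)
  qed
  ultimately show ?thesis using t(3) by (meson order_trans)
qed

text \<open>At scale \<open>\<delta> = (K + 1) powr - \<alpha>\<close> the spikes with indices from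
  \<open>K\<close> to \<open>2 * K\<close> come within \<open>\<alpha> * \<delta>\<close> of every
  point of a box of width of order \<open>K powr (1 - \<alpha>)\<close> and height of order
  \<open>K powr - a\<close>. The volume of this box forces the number of covering sets.\<close>

lemma covering_number_surface_ge:
  defines "c \<equiv> (1 - 2 powr (1 - \<alpha>)) * 2 powr - a / (2 * (1 + \<alpha>)) ^ CARD('m)"
  shows "0 < c"
    and "c * ((real K + 1) powr - \<alpha>) powr - (real CARD('m) - 1 + (1 - a) / \<alpha>)
      \<le> real (covering_number ((real K + 1) powr - \<alpha>) surface)"
proof -
  have two: "2 powr (1 - \<alpha>) < 1" using powr_less_mono[of "1 - \<alpha>" 0 2] \<alpha> by simp
  then show "0 < c" using \<alpha> by (simp add: c_def)
  define y where "y = real K + 1"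
  define \<delta> where "\<delta> = y powr - \<alpha>"
  have y: "0 < y" by (simp add: y_def)
  then have \<delta>: "0 < \<delta>" by (simp add: \<delta>_def)
  define l u :: "real ^ 'm"
    where "l = (\<chi> i. if i = i\<^sub>1 then node \<alpha> (2 * K + 1) else if i = i\<^sub>0 then 1 else - 1)"
      and "u = (\<chi> i. if i = i\<^sub>1 then node \<alpha> K else if i = i\<^sub>0 then 1 + height a (2 * K + 1) else 1)"
  \<comment> \<open>The index \<open>2 * K + 1\<close> is chosen because the shift in
    \<open>node\<close> and \<open>height\<close> turns it into exactly
    \<open>2 * y\<close>.\<close>
  have node: "node \<alpha> K - node \<alpha> (2 * K + 1) = (1 - 2 powr (1 - \<alpha>)) * y powr (1 - \<alpha>)"
  proof -
    have "real (2 * K + 1) + 1 = 2 * y" by (simp add: y_def)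
    then have "node \<alpha> (2 * K + 1) = 2 powr (1 - \<alpha>) * y powr (1 - \<alpha>)"
      unfolding node_def using y by (simp only: powr_mult)
    moreover have "node \<alpha> K = y powr (1 - \<alpha>)" by (simp add: node_def y_def)
    ultimately show ?thesis by (simp add: left_diff_distrib)
  qed
  have height: "height a (2 * K + 1) = 2 powr - a * y powr - a"
  proof -
    have "real (2 * K + 1) + 1 = 2 * y" by (simp add: y_def)
    then show ?thesis unfolding height_def using y by (simp only: powr_mult)
  qed
  have lu: "l $ i \<le> u $ i" for i
    using node_antimono[of K "2 * K + 1"] height_pos[of "2 * K + 1"] by (simp add: l_def u_def)
  have "(1 - 2 powr (1 - \<alpha>)) * 2 powr - a * y powr (1 - \<alpha> - a)
      = (node \<alpha> K - node \<alpha> (2 * K + 1)) * (height a (2 * K + 1) * 1)"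
    unfolding node height using y by (simp add: powr_diff powr_minus divide_simps)
  also have "\<dots> \<le> (node \<alpha> K - node \<alpha> (2 * K + 1)) * (height a (2 * K + 1) * (\<Prod>i\<in>UNIV - {i\<^sub>1} - {i\<^sub>0}. 2))"
    using node_antimono[of K "2 * K + 1"] height_pos[of "2 * K + 1"]
    by (intro mult_left_mono) (auto intro: one_le_power)
  also have "\<dots> = (u $ i\<^sub>1 - l $ i\<^sub>1) * ((u $ i\<^sub>0 - l $ i\<^sub>0) * (\<Prod>i\<in>UNIV - {i\<^sub>1} - {i\<^sub>0}. u $ i - l $ i))"
    using i01 by (intro arg_cong2[where f = "(*)"] prod.cong) (auto simp: l_def u_def)
  also have "\<dots> = (\<Prod>i\<in>UNIV. u $ i - l $ i)"
    using i01 by (simp add: prod.remove[of UNIV i\<^sub>1] prod.remove[of "UNIV - {i\<^sub>1}" i\<^sub>0])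
  also have "\<dots> = measure lebesgue (cbox l u)"
    using lu by (simp add: content_cbox_cart interval_eq_empty_cart not_less)
  also have "\<dots> \<le> covering_number \<delta> surface * (2 * (\<delta> + \<alpha> * \<delta>)) ^ CARD('m)"
  proof -
    obtain c' where c': "coverable \<delta> surface c'" using coverable_surface[OF \<delta>] .
    have "\<exists>z\<in>surface. dist x z \<le> \<alpha> * \<delta>" if x: "x \<in> cbox l u" for x
      unfolding \<delta>_def y_def
    proof (rule near_surface)
      have xi: "l $ i \<le> x $ i" "x $ i \<le> u $ i" for i using x by (auto simp: mem_box_cart)
      show "node \<alpha> (2 * K + 1) \<le> x $ i\<^sub>1" "x $ i\<^sub>1 \<le> node \<alpha> K"
        using xi[of i\<^sub>1] by (simp_all add: l_def u_def)
      show "1 \<le> x $ i\<^sub>0" "x $ i\<^sub>0 \<le> 1 + height a (2 * K + 1)"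
        using xi[of i\<^sub>0] i01 by (simp_all add: l_def u_def)
      show "\<bar>x $ i\<bar> \<le> 1" if "i \<noteq> i\<^sub>0" "i \<noteq> i\<^sub>1" for i
        using xi[of i] that by (simp add: l_def u_def abs_le_iff)
    qed
    then show ?thesis
      using \<alpha> \<delta> by (intro covering_number_volume_bound[OF c']) auto
  qed
  also have "\<dots> = covering_number \<delta> surface * (2 * (1 + \<alpha>)) ^ CARD('m) * \<delta> ^ CARD('m)"
    by (simp add: algebra_simps flip: power_mult_distrib)
  finally have "c * y powr (1 - \<alpha> - a) \<le> covering_number \<delta> surface * \<delta> ^ CARD('m)"
    unfolding c_def using \<alpha> by (simp add: pos_divide_le_eq mult_ac)
  then have "c * (y powr (1 - \<alpha> - a) / \<delta> ^ CARD('m)) \<le> covering_number \<delta> surface"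
    using \<delta> by (simp add: pos_divide_le_eq)
  \<comment> \<open>Rewriting \<open>y\<close> as a power of \<open>\<delta>\<close> produces the
    exponent of the dimension formula.\<close>
  moreover have "y powr (1 - \<alpha> - a) / \<delta> ^ CARD('m) = \<delta> powr - (real CARD('m) - 1 + (1 - a) / \<alpha>)"
  proof -
    have "\<delta> ^ CARD('m) = y powr (- \<alpha> * real CARD('m))"
      using \<delta> y by (simp add: \<delta>_def powr_powr flip: powr_realpow)
    moreover have "(1 - \<alpha> - a) - (- \<alpha> * real CARD('m)) = - \<alpha> * - (real CARD('m) - 1 + (1 - a) / \<alpha>)"
      using \<alpha> by (simp add: field_simps)
    ultimately show ?thesis unfolding \<delta>_def powr_powr by (metis powr_diff)
  qed
  ultimately have "c * \<delta> powr - (real CARD('m) - 1 + (1 - a) / \<alpha>) \<le> covering_number \<delta> surface"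
    by simp
  then show "c * ((real K + 1) powr - \<alpha>) powr - (real CARD('m) - 1 + (1 - a) / \<alpha>)
      \<le> real (covering_number ((real K + 1) powr - \<alpha>) surface)"
    unfolding \<delta>_def y_def .
qed

section \<open>Upper bound for the covering numbers\<close>

definition face :: "'m \<Rightarrow> real \<Rightarrow> (real ^ 'm) set" where
  "face i s = cbox (\<chi> j. if j = i then s else - 2) (\<chi> j. if j = i then s else 2)"

text \<open>The slanted sides of a spike, parametrised by the height above the cube.\<close>

definition sheet_map :: "nat \<Rightarrow> real \<Rightarrow> real \<Rightarrow> real ^ 'm \<Rightarrow> real ^ 'm" where
  "sheet_map k s t x = (\<chi> i. if i = i\<^sub>1 then centre \<alpha> k + t * (width \<alpha> k / 2) * (1 - x $ i\<^sub>0 / height a k)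
     else if i = i\<^sub>0 then s * (1 + x $ i\<^sub>0) else x $ i)"

text \<open>The coordinate \<open>i\<^sub>1\<close> is frozen at 0 because \<open>sheet_map\<close>
  computes its new value from the height stored in coordinate \<open>i\<^sub>0\<close>.\<close>

definition sheet_box :: "nat \<Rightarrow> (real ^ 'm) set" where
  "sheet_box k = cbox (\<chi> i. if i = i\<^sub>1 then 0 else if i = i\<^sub>0 then 0 else - 1)
     (\<chi> i. if i = i\<^sub>1 then 0 else if i = i\<^sub>0 then height a k else 1)"

text \<open>A box around the parts of all spikes of index at least \<open>K\<close> that stick out
  of the cube, at the top for \<open>s = 1\<close> and at the bottom for
  \<open>s = -1\<close>.\<close>

definition tail :: "nat \<Rightarrow> real \<Rightarrow> (real ^ 'm) set" where
  "tail K s = cbox (\<chi> i. if i = i\<^sub>1 then 0 else if i = i\<^sub>0 then (if s = 1 then 1 else - 1 - height a K) else - 1)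
     (\<chi> i. if i = i\<^sub>1 then node \<alpha> K else if i = i\<^sub>0 then (if s = 1 then 1 + height a K else - 1) else 1)"

text \<open>Points with some coordinate equal to 1 or -1 lie in a flat plate. Any other point lies
  on the slope of a single spike: early spikes are covered sheet by sheet, late ones by the two
  boxes.\<close>

lemma surface_subset_pieces:
  "surface \<subseteq> (\<Union>i\<in>UNIV. \<Union>s\<in>{-1, 1}. face i s) \<union>
     (\<Union>k\<in>{..<K}. \<Union>s\<in>{-1, 1}. \<Union>t\<in>{-1, 1}. sheet_map k s t ` sheet_box k) \<union> (\<Union>s\<in>{-1, 1}. tail K s)"
    (is "_ \<subseteq> ?F \<union> ?T \<union> ?Z")
proof
  fix x assume x: "x \<in> surface"
  have xi: "\<bar>x $ i\<bar> \<le> 1" if "i \<noteq> i\<^sub>0" for i using x that by (simp add: mem_surface_iff)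
  have face: "x \<in> ?F" if "\<bar>x $ i\<bar> = 1" for i
  proof -
    have "- 2 \<le> x $ j \<and> x $ j \<le> 2" for j using abs_nth_surface_le_2[OF x, of j] by (simp add: abs_le_iff)
    then have "x \<in> face i (x $ i)" by (auto simp: face_def mem_box_cart)
    moreover have "x $ i \<in> {-1, 1}" using that by (auto simp: abs_if split: if_splits)
    ultimately show ?thesis by blast
  qed
  consider (1) i where "\<bar>x $ i\<bar> = 1" | (2) "\<bar>x $ i\<^sub>0\<bar> = 1 + g (x $ i\<^sub>1)" "\<bar>x $ i\<^sub>0\<bar> \<noteq> 1"
  proof (cases "\<exists>i. \<bar>x $ i\<bar> = 1")
    case True
    then show thesis using that(1) by blast
  next
    case False
    then have "\<bar>x $ i\<bar> < 1" if "i \<noteq> i\<^sub>0" for i using xi[OF that] by (simp add: order_less_le)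
    then have "\<bar>x $ i\<^sub>0\<bar> = 1 + g (x $ i\<^sub>1)" using x unfolding mem_surface_iff by fastforce
    then show thesis using that(2) False by blast
  qed
  then show "x \<in> ?F \<union> ?T \<union> ?Z"
  proof cases
    case 1
    then show ?thesis using face[of i] by (intro UnI1)
  next
    case 2
    then have gp: "0 < g (x $ i\<^sub>1)" using profile_nonneg[of "x $ i\<^sub>1"] by simp
    then obtain k where k: "g (x $ i\<^sub>1) = tent \<alpha> a k (x $ i\<^sub>1)" by (rule profile_attained)
    define h where "h = tent \<alpha> a k (x $ i\<^sub>1)"
    have h: "0 < h" "h \<le> height a k" using gp tent_le unfolding h_def k by auto
    have heq: "h = height a k * (1 - 2 * \<bar>x $ i\<^sub>1 - centre \<alpha> k\<bar> / width \<alpha> k)"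
      using h(1) unfolding h_def by (rule tent_eq)
    \<comment> \<open>The signs select the upper or lower spike and its right or left side.\<close>
    define s :: real where "s = (if 0 \<le> x $ i\<^sub>0 then 1 else - 1)"
    define t :: real where "t = (if 0 \<le> x $ i\<^sub>1 - centre \<alpha> k then 1 else - 1)"
    have st: "s \<in> {-1, 1}" "t \<in> {-1, 1}" by (auto simp: s_def t_def)
    have sx: "x $ i\<^sub>0 = s * (1 + h)" using 2 unfolding h_def k s_def by (auto simp: abs_if split: if_splits)
    show ?thesis
    proof (cases "k < K")
      case True
      \<comment> \<open>The preimage records the height \<open>h\<close> of \<open>x\<close> above
        the cube and forgets the coordinate \<open>i\<^sub>1\<close>.\<close>
      define z where "z = (\<chi> i. if i = i\<^sub>1 then 0 else if i = i\<^sub>0 then h else x $ i)"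
      have "z \<in> sheet_box k"
        using xi h i01 by (auto simp: sheet_box_def mem_box_cart z_def abs_le_iff minus_le_iff)
      moreover have "x = sheet_map k s t z"
      proof -
        have "1 - h / height a k = 2 * \<bar>x $ i\<^sub>1 - centre \<alpha> k\<bar> / width \<alpha> k"
          using heq height_pos[of k] by (simp add: field_simps)
        then have "t * (width \<alpha> k / 2) * (1 - h / height a k) = x $ i\<^sub>1 - centre \<alpha> k"
          using width_pos[of k] by (simp add: t_def)
        then show ?thesis using sx i01 by (auto simp: sheet_map_def z_def vec_eq_iff diff_divide_distrib)
      qed
      ultimately have "x \<in> sheet_map k s t ` sheet_box k" by simp
      then have "x \<in> (\<Union>t\<in>{-1, 1}. sheet_map k s t ` sheet_box k)" using st(2) by (rule UN_I[rotated])
      then have "x \<in> (\<Union>s\<in>{-1, 1}. \<Union>t\<in>{-1, 1}. sheet_map k s t ` sheet_box k)"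
        using st(1) by (rule UN_I[rotated])
      then have "x \<in> ?T" using True by (intro UN_I[of k]) auto
      then show ?thesis by (intro UnI1 UnI2)
    next
      case False
      have "node \<alpha> (Suc k) < x $ i\<^sub>1" "x $ i\<^sub>1 < node \<alpha> k"
        using h(1) width_le_gap[of k] unfolding h_def tent_pos_iff by auto
      moreover have "node \<alpha> k \<le> node \<alpha> K" using False by (intro node_antimono) simp
      ultimately have x1: "0 \<le> x $ i\<^sub>1" "x $ i\<^sub>1 \<le> node \<alpha> K"
        using node_pos[of "Suc k"] by linarith+
      have hK: "h \<le> height a K" using h(2) height_antimono[of K k] False by simp
      have sx': "s = 1 \<Longrightarrow> x $ i\<^sub>0 = 1 + h" "s \<noteq> 1 \<Longrightarrow> x $ i\<^sub>0 = - 1 - h"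
        using sx st(1) by auto
      have "x \<in> tail K s"
        unfolding tail_def mem_box_cart
      proof (intro allI conjI)
        fix i
        show "(\<chi> i. if i = i\<^sub>1 then 0 else if i = i\<^sub>0 then (if s = 1 then 1 else - 1 - height a K) else - 1) $ i \<le> x $ i"
          using x1 h(1) hK i01 xi[of i] by (cases "s = 1") (simp_all add: sx' abs_le_iff)
        show "x $ i \<le> (\<chi> i. if i = i\<^sub>1 then node \<alpha> K else if i = i\<^sub>0 then (if s = 1 then 1 + height a K else - 1) else 1) $ i"
          using x1 h(1) hK i01 xi[of i] by (cases "s = 1") (simp_all add: sx' abs_le_iff)
      qed
      then have "x \<in> ?Z" by (rule UN_I[OF st(1)])
      then show ?thesis by (rule UnI2)
    qed
  qed
qed

text \<open>The unslanted part does not increase the norm, and the slant in direction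
  \<open>i\<^sub>1\<close> is at most the norm because
  \<open>width \<alpha> k \<le> height a k\<close>.\<close>

lemma lipschitz_sheet_map:
  assumes "s \<in> {-1, 1}" "t \<in> {-1, 1}"
  shows "2-lipschitz_on E (sheet_map k s t)"
proof (rule lipschitz_onI)
  fix x y :: "real ^ 'm"
  define v where "v = x - y"
  define w where "w = t * (width \<alpha> k / 2) * (v $ i\<^sub>0 / height a k)"
  define A where "A = (\<chi> i. if i = i\<^sub>1 then 0 else if i = i\<^sub>0 then s * v $ i\<^sub>0 else v $ i)"
  have "sheet_map k s t x - sheet_map k s t y = A - axis i\<^sub>1 w"
    unfolding vec_eq_iff
  proof
    fix i
    show "(sheet_map k s t x - sheet_map k s t y) $ i = (A - axis i\<^sub>1 w) $ i"
    proof (cases "i = i\<^sub>1")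
      case True
      define c where "c = t * (width \<alpha> k / 2)"
      have "c * (1 - x $ i\<^sub>0 / height a k) - c * (1 - y $ i\<^sub>0 / height a k)
          = - (c * ((x $ i\<^sub>0 - y $ i\<^sub>0) / height a k))"
        by (simp add: diff_divide_distrib right_diff_distrib)
      then show ?thesis using True by (simp add: sheet_map_def A_def w_def v_def axis_def c_def)
    next
      case False
      then show ?thesis by (simp add: sheet_map_def A_def v_def axis_def algebra_simps)
    qed
  qed
  then have "dist (sheet_map k s t x) (sheet_map k s t y) \<le> norm A + norm (axis i\<^sub>1 w)"
    by (simp add: dist_norm norm_triangle_ineq4)
  also have "norm A \<le> norm v"
    using assms by (intro norm_le_componentwise_cart) (auto simp: A_def)
  also have "norm (axis i\<^sub>1 w) = \<bar>w\<bar>" by (simp add: norm_eq_sqrt_inner inner_axis_axis)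
  also have "\<bar>w\<bar> \<le> norm v"
  proof -
    have "\<bar>w\<bar> = (width \<alpha> k / 2 / height a k) * \<bar>v $ i\<^sub>0\<bar>"
      using assms width_pos[of k] height_pos[of k] by (auto simp: w_def abs_mult)
    also have "\<dots> \<le> 1 * norm v"
      using width_pos[of k] width_le_height[of k] component_le_norm_cart[of v i\<^sub>0]
      by (intro mult_mono) auto
    finally show ?thesis by simp
  qed
  finally show "dist (sheet_map k s t x) (sheet_map k s t y) \<le> 2 * dist x y"
    by (simp add: v_def dist_norm)
qed simp

text \<open>The degenerate edge in direction \<open>i\<close> contributes a factor 1, so one power
  of \<open>1 / \<delta>\<close> is saved.\<close>

lemma coverable_face:
  assumes d: "0 < \<delta>" "\<delta> \<le> 1" and s: "s \<in> {-1, 1}"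
  shows "coverable \<delta> (face i s) (((4 * CARD('m) + 1) / \<delta>) ^ (CARD('m) - 2 + 1))"
proof -
  obtain j where j: "i \<noteq> j" using i01 by metis
  let ?a = "\<chi> j. if j = i then s else - 2" and ?b = "\<chi> j. if j = i then s else 2"
  let ?L = "(4 * CARD('m) + 1) / \<delta>"
  have c: "coverable \<delta> (face i s) ((CARD('m) * (?b $ i - ?a $ i) / \<delta> + 1) * (CARD('m) * (?b $ j - ?a $ j) / \<delta> + 1)
           * ?L ^ (CARD('m) - 2))"
    unfolding face_def by (rule coverable_cbox_two_sides[OF j d]) auto
  have "CARD('m) * 4 / \<delta> + 1 \<le> ?L"
    using d by (simp add: add_divide_distrib mult.commute)
  then have "(CARD('m) * 4 / \<delta> + 1) * ?L ^ (CARD('m) - 2) \<le> ?L * ?L ^ (CARD('m) - 2)"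
    using d by (intro mult_right_mono) auto
  then show ?thesis using j by (intro coverable_mono[OF c]) auto
qed

lemma coverable_sheet:
  assumes d: "0 < \<delta>" "\<delta> \<le> 1" and st: "s \<in> {-1, 1}" "t \<in> {-1, 1}"
  shows "coverable (2 * \<delta>) (sheet_map k s t ` sheet_box k)
     ((CARD('m) * height a k / \<delta> + 1) * ((4 * CARD('m) + 1) / \<delta>) ^ (CARD('m) - 2))"
proof -
  let ?a = "\<chi> i. if i = i\<^sub>1 then 0 else if i = i\<^sub>0 then 0 else - 1"
  let ?b = "\<chi> i. if i = i\<^sub>1 then 0 else if i = i\<^sub>0 then height a k else 1"
  have "coverable \<delta> (cbox ?a ?b) ((CARD('m) * (?b $ i\<^sub>0 - ?a $ i\<^sub>0) / \<delta> + 1)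
     * (CARD('m) * (?b $ i\<^sub>1 - ?a $ i\<^sub>1) / \<delta> + 1) * ((4 * CARD('m) + 1) / \<delta>) ^ (CARD('m) - 2))"
    using height_pos[of k] height_le_1[of k] by (intro coverable_cbox_two_sides[OF i01 d]) auto
  then have "coverable \<delta> (sheet_box k) ((CARD('m) * height a k / \<delta> + 1) * ((4 * CARD('m) + 1) / \<delta>) ^ (CARD('m) - 2))"
    unfolding sheet_box_def using i01 by simp
  then show ?thesis by (rule coverable_lipschitz_image[OF _ lipschitz_sheet_map[OF st]])
qed

lemma coverable_tail:
  assumes d: "0 < \<delta>" "\<delta> \<le> 1" and s: "s \<in> {-1, 1}"
  shows "coverable \<delta> (tail K s) ((CARD('m) * node \<alpha> K / \<delta> + 1) * (CARD('m) * height a K / \<delta> + 1)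
     * ((4 * CARD('m) + 1) / \<delta>) ^ (CARD('m) - 2))"
proof -
  let ?a = "\<chi> i. if i = i\<^sub>1 then 0 else if i = i\<^sub>0 then (if s = 1 then 1 else - 1 - height a K) else - 1"
  let ?b = "\<chi> i. if i = i\<^sub>1 then node \<alpha> K else if i = i\<^sub>0 then (if s = 1 then 1 + height a K else - 1) else 1"
  have "coverable \<delta> (cbox ?a ?b) ((CARD('m) * (?b $ i\<^sub>1 - ?a $ i\<^sub>1) / \<delta> + 1)
     * (CARD('m) * (?b $ i\<^sub>0 - ?a $ i\<^sub>0) / \<delta> + 1) * ((4 * CARD('m) + 1) / \<delta>) ^ (CARD('m) - 2))"
    using height_pos[of K] height_le_1[of K] node_pos[of K] node_le_1[of K] i01
    by (intro coverable_cbox_two_sides[OF i01[symmetric] d]) auto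
  moreover have "?b $ i\<^sub>1 - ?a $ i\<^sub>1 = node \<alpha> K" "?b $ i\<^sub>0 - ?a $ i\<^sub>0 = height a K"
    using i01 by auto
  ultimately show ?thesis unfolding tail_def by (simp only:)
qed

text \<open>The summands count the plates, four sheets for each of the first \<open>K\<close> tents,
  and the two boxes around the rest. The scale is \<open>2 * \<delta>\<close> because of the
  Lipschitz constant of the sheets.\<close>

lemma coverable_surface_pieces:
  fixes L :: real
  assumes d: "0 < \<delta>" "\<delta> \<le> 1"
  defines "L \<equiv> real (4 * CARD('m) + 1) / \<delta>"
  shows "coverable (2 * \<delta>) surface
    (2 * CARD('m) * L ^ (CARD('m) - 2 + 1)
     + 4 * (\<Sum>k<K. CARD('m) * height a k / \<delta> + 1) * L ^ (CARD('m) - 2)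
     + 2 * ((CARD('m) * node \<alpha> K / \<delta> + 1) * (CARD('m) * height a K / \<delta> + 1)) * L ^ (CARD('m) - 2))"
proof -
  have d2: "\<delta> \<le> 2 * \<delta>" using d by simp
  note fc = coverable_mono[OF coverable_face[OF d] order_refl order_refl d2, folded L_def]
  note tl = coverable_mono[OF coverable_tail[OF d] order_refl order_refl d2, folded L_def]
  note sh = coverable_sheet[OF d, folded L_def]
  have F: "coverable (2 * \<delta>) (\<Union>i\<in>UNIV. \<Union>s\<in>{-1, 1}. face i s)
      (\<Sum>i\<in>(UNIV::'m set). \<Sum>s\<in>{-1, 1::real}. L ^ (CARD('m) - 2 + 1))"
    by (intro coverable_UN fc) auto
  have T: "coverable (2 * \<delta>) (\<Union>k\<in>{..<K}. \<Union>s\<in>{-1, 1}. \<Union>t\<in>{-1, 1}. sheet_map k s t ` sheet_box k)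
      (\<Sum>k\<in>{..<K}. \<Sum>s\<in>{-1, 1::real}. \<Sum>t\<in>{-1, 1::real}. (CARD('m) * height a k / \<delta> + 1) * L ^ (CARD('m) - 2))"
    by (intro coverable_UN sh) auto
  have Z: "coverable (2 * \<delta>) (\<Union>s\<in>{-1, 1}. tail K s)
      (\<Sum>s\<in>{-1, 1::real}. (CARD('m) * node \<alpha> K / \<delta> + 1) * (CARD('m) * height a K / \<delta> + 1) * L ^ (CARD('m) - 2))"
    by (intro coverable_UN tl) auto
  have four: "(\<Sum>k<K. \<Sum>s\<in>{-1, 1::real}. \<Sum>t\<in>{-1, 1::real}. (CARD('m) * height a k / \<delta> + 1) * L ^ (CARD('m) - 2))
     = 4 * (\<Sum>k<K. CARD('m) * height a k / \<delta> + 1) * L ^ (CARD('m) - 2)"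
    by (simp add: mult.assoc flip: sum_distrib_left sum_distrib_right)
  show ?thesis
    by (rule coverable_mono[OF coverable_Un[OF coverable_Un[OF F T] Z] surface_subset_pieces _ order_refl])
      (simp only: four, simp add: mult.assoc)
qed

text \<open>The cut-off \<open>K\<close> is taken of order
  \<open>\<delta> powr (- 1 / \<alpha>)\<close>, where gaps have length of order \<delta>. The
  sheets and the boxes then both give \<open>\<delta> powr (- 1 - e)\<close>, and the other
  \<open>m\<close> directions give \<open>\<delta> powr - m\<close>.\<close>

lemma covering_number_surface_le:
  "\<exists>C\<ge>1. \<forall>\<delta>. 0 < \<delta> \<and> \<delta> < 1 \<longrightarrow>
     real (covering_number \<delta> surface) \<le> C * \<delta> powr - (real CARD('m) - 1 + (1 - a) / \<alpha>)"
proof -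
  \<comment> \<open>Here \<open>n\<close> is the dimension of the ambient space as a real number,
    and \<open>m\<close> counts the directions other than the two distinguished ones.\<close>
  define n where "n = real CARD('m)"
  define m where "m = CARD('m) - 2"
  define e where "e = (1 - a) / \<alpha>"
  define M where "M = 4 * n + 1"
  define dim where "dim = real CARD('m) - 1 + (1 - a) / \<alpha>"
  define C where "C = 2 * n * M ^ (m + 1) + 4 * (2 * n / (1 - a) + 2) * M ^ m + 2 * (n + 1)\<^sup>2 * M ^ m"
  have n: "2 \<le> n" using card_index_ge_2 by (simp add: n_def)
  have M: "1 \<le> M" using n by (simp add: M_def)
  have e: "0 < e" "e \<le> 1" using a \<alpha> by (simp_all add: e_def)
  have dim: "dim = real m + 1 + e" using card_index_ge_2 by (simp add: dim_def m_def e_def of_nat_diff)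
  have C1: "1 \<le> C"
  proof -
    have "1 * 1 * 1 \<le> 2 * n * M ^ (m + 1)"
      using n M one_le_power[OF M, of "m + 1"] by (intro mult_mono) auto
    moreover have "0 \<le> 4 * (2 * n / (1 - a) + 2) * M ^ m" "0 \<le> 2 * (n + 1)\<^sup>2 * M ^ m"
      using n M a by simp_all
    ultimately show ?thesis unfolding C_def by linarith
  qed
  have main: "coverable (2 * \<delta>) surface (C * \<delta> powr - dim)" if d: "0 < \<delta>" "\<delta> \<le> 1" for \<delta>
  proof -
    define x where "x = \<delta> powr (- 1 / \<alpha>)"
    have mono: "\<delta> powr p \<le> \<delta> powr q" if "q \<le> p" for p q using d that by (intro powr_mono') auto
    have ge1: "1 \<le> \<delta> powr q" if "q \<le> 0" for q using mono[OF that] d by simp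
    have x1: "1 \<le> x" unfolding x_def using \<alpha> by (intro ge1) simp
    define K where "K = nat \<lceil>x\<rceil>"
    have K: "x \<le> real K" "real K \<le> 2 * x" using x1 unfolding K_def by linarith+
    have xp: "x powr p = \<delta> powr (- p / \<alpha>)" for p by (simp add: x_def powr_powr)
    have Lm: "(M / \<delta>) ^ j = M ^ j * \<delta> powr - real j" for j
      using d by (simp add: power_divide powr_minus_divide powr_realpow)
    have "(\<Sum>k<K. n * height a k / \<delta> + 1) = n / \<delta> * (\<Sum>k<K. (real k + 1) powr - a) + real K"
      by (simp add: height_def sum.distrib sum_distrib_left)
    also have "\<dots> \<le> n / \<delta> * (real K powr (1 - a) / (1 - a)) + real K"
      using sum_powr_le[OF a] n d by (intro add_right_mono mult_left_mono) auto
    also have "\<dots> \<le> n / \<delta> * (2 * \<delta> powr - e / (1 - a)) + 2 * \<delta> powr (- 1 - e)"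
    proof (intro add_mono mult_left_mono divide_right_mono)
      have "real K powr (1 - a) \<le> (2 * x) powr (1 - a)" using K a by (intro powr_mono2) auto
      also have "\<dots> = 2 powr (1 - a) * \<delta> powr - e"
        using x1 by (simp add: powr_mult xp e_def minus_divide_left)
      also have "\<dots> \<le> 2 powr 1 * \<delta> powr - e" using a by (intro mult_right_mono powr_mono) auto
      finally show "real K powr (1 - a) \<le> 2 * \<delta> powr - e" by simp
      \<comment> \<open>This absorbs the rounding term 1 contributed by each of the \<open>K\<close>
        tents.\<close>
      have "- 1 - e \<le> - 1 / \<alpha>" using \<alpha> a by (simp add: e_def field_simps)
      then have "x \<le> \<delta> powr (- 1 - e)" unfolding x_def by (rule mono)
      then show "real K \<le> 2 * \<delta> powr (- 1 - e)" using K by linarith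
    qed (use n d a in auto)
    also have "\<dots> = (2 * n / (1 - a) + 2) * \<delta> powr (- 1 - e)"
    proof -
      have "\<delta> powr (- 1 - e) = \<delta> powr - e / \<delta>"
      proof -
        have eq: "- 1 - e = - e - 1" by simp
        show ?thesis unfolding eq powr_diff using d by simp
      qed
      moreover have "n / \<delta> * (2 * w / c) + 2 * (w / \<delta>) = (2 * n / c + 2) * (w / \<delta>)" if "0 < c" for w c
        using d(1) that by (simp add: field_simps)
      ultimately show ?thesis using a by simp
    qed
    finally have S: "(\<Sum>k<K. n * height a k / \<delta> + 1) \<le> (2 * n / (1 - a) + 2) * \<delta> powr (- 1 - e)" .
    have P: "n * node \<alpha> K / \<delta> + 1 \<le> (n + 1) * \<delta> powr (- 1 / \<alpha>)"
    proof -
      have "node \<alpha> K \<le> x powr (1 - \<alpha>)"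
        unfolding node_def using K x1 \<alpha> by (intro powr_mono2') auto
      also have "\<dots> = \<delta> powr (- 1 / \<alpha>) * \<delta>"
      proof -
        have eq: "- (1 - \<alpha>) / \<alpha> = - 1 / \<alpha> + 1" using \<alpha> by (simp add: field_simps)
        show ?thesis unfolding xp eq powr_add using d by simp
      qed
      finally have "n * node \<alpha> K / \<delta> \<le> n * \<delta> powr (- 1 / \<alpha>)"
        using d n by (simp add: pos_divide_le_eq)
      then show ?thesis using x1 unfolding x_def by (simp add: distrib_right)
    qed
    have H: "n * height a K / \<delta> + 1 \<le> (n + 1) * \<delta> powr (a / \<alpha> - 1)"
    proof -
      have "height a K \<le> x powr - a"
        unfolding height_def using K x1 a by (intro powr_mono2') auto
      also have "\<dots> = \<delta> powr (a / \<alpha> - 1) * \<delta>"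
        using d by (simp add: xp powr_diff)
      finally have "n * height a K / \<delta> \<le> n * \<delta> powr (a / \<alpha> - 1)"
        using d n by (simp add: pos_divide_le_eq)
      moreover have "1 \<le> \<delta> powr (a / \<alpha> - 1)" using a \<alpha> by (intro ge1) (simp add: field_simps)
      ultimately show ?thesis by (simp add: distrib_right)
    qed
    have "(n * node \<alpha> K / \<delta> + 1) * (n * height a K / \<delta> + 1)
        \<le> ((n + 1) * \<delta> powr (- 1 / \<alpha>)) * ((n + 1) * \<delta> powr (a / \<alpha> - 1))"
      using n d node_pos[of K] height_pos[of K] by (intro mult_mono P H) auto
    also have "\<dots> = (n + 1)\<^sup>2 * (\<delta> powr (- 1 / \<alpha>) * \<delta> powr (a / \<alpha> - 1))"
      by (simp add: power2_eq_square)
    also have "\<delta> powr (- 1 / \<alpha>) * \<delta> powr (a / \<alpha> - 1) = \<delta> powr (- 1 - e)"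
    proof -
      have eq: "- 1 - e = - 1 / \<alpha> + (a / \<alpha> - 1)" by (simp add: e_def diff_divide_distrib)
      show ?thesis unfolding eq powr_add ..
    qed
    finally have PH: "(n * node \<alpha> K / \<delta> + 1) * (n * height a K / \<delta> + 1) \<le> (n + 1)\<^sup>2 * \<delta> powr (- 1 - e)" .
    have prod: "\<delta> powr (- 1 - e) * \<delta> powr - real m = \<delta> powr - dim"
    proof -
      have eq: "- dim = - 1 - e + - real m" by (simp add: dim)
      show ?thesis unfolding eq powr_add ..
    qed
    have "2 * n * (M / \<delta>) ^ (m + 1) + 4 * (\<Sum>k<K. n * height a k / \<delta> + 1) * (M / \<delta>) ^ m
       + 2 * ((n * node \<alpha> K / \<delta> + 1) * (n * height a K / \<delta> + 1)) * (M / \<delta>) ^ m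
      \<le> 2 * n * (M ^ (m + 1) * \<delta> powr - dim) + 4 * ((2 * n / (1 - a) + 2) * \<delta> powr (- 1 - e)) * (M / \<delta>) ^ m
       + 2 * ((n + 1)\<^sup>2 * \<delta> powr (- 1 - e)) * (M / \<delta>) ^ m"
    proof (intro add_mono mult_left_mono mult_right_mono S PH)
      show "(M / \<delta>) ^ (m + 1) \<le> M ^ (m + 1) * \<delta> powr - dim"
        unfolding Lm using M e by (intro mult_left_mono mono) (auto simp: dim)
    qed (use n M d in auto)
    also have "\<dots> = C * (\<delta> powr - dim)"
      unfolding C_def Lm prod[symmetric] by (simp add: algebra_simps)
    finally show ?thesis
      by (intro coverable_mono[OF coverable_surface_pieces[OF d, of K]]) (auto simp: n_def m_def M_def add.commute[of 1 "4 * real CARD('m)"])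
  qed
  show ?thesis
  \<comment> \<open>Applying the estimate at \<open>\<delta> / 2\<close> turns the scale
    \<open>2 * \<delta>\<close> into \<delta> at the cost of the factor
    \<open>2 powr dim\<close>.\<close>
  proof (intro exI[of _ "C * 2 powr dim"] conjI allI impI; (elim conjE)?)
    have "1 \<le> 2 powr dim" using powr_mono[of 0 dim 2] dim e by simp
    then have "1 * 1 \<le> C * 2 powr dim" using C1 by (intro mult_mono) auto
    then show "1 \<le> C * 2 powr dim" by simp
    fix \<delta> :: real assume d: "0 < \<delta>" "\<delta> < 1"
    have "real (covering_number (2 * (\<delta> / 2)) surface) \<le> C * (\<delta> / 2) powr - dim"
      using d by (intro coverable_imp_covering_number_le main) auto
    also have "(\<delta> / 2) powr - dim = 2 powr dim * \<delta> powr - dim"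
      using d by (simp add: powr_divide powr_minus divide_simps)
    finally show "real (covering_number \<delta> surface) \<le> C * 2 powr dim * \<delta> powr - (real CARD('m) - 1 + (1 - a) / \<alpha>)"
      by (simp add: dim_def)
  qed
qed

lemma upper_Minkowski_dim_surface:
  "upper_Minkowski_dim surface = ereal (real CARD('m) - 1 + (1 - a) / \<alpha>)"
proof -
  obtain C where C: "1 \<le> C"
    "\<And>\<delta>. 0 < \<delta> \<Longrightarrow> \<delta> < 1 \<Longrightarrow> real (covering_number \<delta> surface) \<le> C * \<delta> powr - (real CARD('m) - 1 + (1 - a) / \<alpha>)"
    using covering_number_surface_le by blast
  have "(\<lambda>K. (real K + 1) powr - \<alpha>) \<longlonglongrightarrow> 0"
  proof -
    have "filterlim (\<lambda>K. real K + 1) at_top sequentially"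
      using filterlim_compose[OF filterlim_real_sequentially filterlim_Suc] by (simp add: add.commute)
    then show ?thesis using \<alpha> by (intro tendsto_neg_powr) auto
  qed
  then show ?thesis
    using covering_number_surface_ge card_index_ge_2 a \<alpha>
    by (intro upper_Minkowski_dim_eqI[OF _ C, where \<eta> = "\<lambda>K. (real K + 1) powr - \<alpha>"]) auto
qed

end

section \<open>Distinct parameters give distinct surfaces\<close>

lemma surface_centre_iff:
  fixes i\<^sub>0 i\<^sub>1 :: "'m::finite"
  assumes "spiked_cube \<alpha> a i\<^sub>0 i\<^sub>1"
  shows "(\<exists>x\<in>spiked_cube.surface \<alpha> a i\<^sub>0 i\<^sub>1. x $ i\<^sub>0 = 2 \<and> x $ i\<^sub>1 = t) \<longleftrightarrow> t = centre \<alpha> 0"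
proof -
  interpret spiked_cube \<alpha> a i\<^sub>0 i\<^sub>1 by fact
  show ?thesis
  proof
    assume "\<exists>x\<in>surface. x $ i\<^sub>0 = 2 \<and> x $ i\<^sub>1 = t"
    then have "1 \<le> profile \<alpha> a t" by (auto simp: mem_surface_iff)
    then show "t = centre \<alpha> 0" using profile_le_1[of t] profile_eq_1_iff[of t] by simp
  next
    assume t: "t = centre \<alpha> 0"
    then have "profile \<alpha> a t = 1" by (simp add: profile_eq_1_iff)
    moreover have "0 \<le> t" "t \<le> 1"
      using t width_pos[of 0] width_le_gap[of 0] node_pos[of 1] node_le_1[of 0] by (auto simp: centre_def)
    ultimately have "(\<chi> i. if i = i\<^sub>0 then 2 else t) \<in> surface"
      unfolding mem_surface_iff using i01 by simp
    then show "\<exists>x\<in>surface. x $ i\<^sub>0 = 2 \<and> x $ i\<^sub>1 = t" using i01 by (intro bexI) auto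
  qed
qed

text \<open>The surface reaches level 2 only above \<open>centre \<alpha> 0\<close>, which equals
  \<open>(1 + 2 powr (1 - \<alpha>)) / 2\<close> and is injective in \<alpha>.\<close>

lemma surface_inj:
  fixes i\<^sub>0 i\<^sub>1 :: "'m::finite"
  assumes "spiked_cube \<alpha> a i\<^sub>0 i\<^sub>1" "spiked_cube \<alpha>' a' i\<^sub>0 i\<^sub>1"
    and "spiked_cube.surface \<alpha> a i\<^sub>0 i\<^sub>1 = spiked_cube.surface \<alpha>' a' i\<^sub>0 i\<^sub>1"
  shows "\<alpha> = \<alpha>'"
proof -
  have "centre \<alpha> 0 = centre \<alpha>' 0"
    using surface_centre_iff[OF assms(1), of "centre \<alpha> 0"] surface_centre_iff[OF assms(2), of "centre \<alpha> 0"]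
      assms(3) by simp
  then have "2 powr (1 - \<alpha>) + (1 - 2 powr (1 - \<alpha>)) / 2 = 2 powr (1 - \<alpha>') + (1 - 2 powr (1 - \<alpha>')) / (2::real)"
    by (simp add: centre_def width_def node_def)
  moreover have "u = v" if "u + (1 - u) / 2 = v + (1 - v) / 2" for u v :: real
    using that by (simp add: field_simps)
  ultimately have "(2::real) powr (1 - \<alpha>) = 2 powr (1 - \<alpha>')" by blast
  then show ?thesis by (simp add: powr_inj)
qed

theorem theorem10:
  fixes n :: nat and d :: real
  assumes "n \<ge> 2" and "CARD('m::finite) = n + 1"
    and "real n < d" and "d < real n + 1"
  shows "\<exists>(P :: (real \<times> real) set) (S :: real \<Rightarrow> real \<Rightarrow> (real ^ 'm) set).
           (\<forall>(\<alpha>, \<beta>)\<in>P. \<alpha> \<ge> 1 \<and> \<beta> \<ge> real n) \<and>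
           uncountable ((\<lambda>(\<alpha>, \<beta>). S \<alpha> \<beta>) ` P) \<and>
           (\<forall>(\<alpha>, \<beta>)\<in>P.
              compact_topological_hypersurface n (S \<alpha> \<beta>) \<and>
              boundary_of_Jordan_domain (S \<alpha> \<beta>) \<and>
              upper_Minkowski_dim (S \<alpha> \<beta>) = ereal d \<and>
              (\<forall>r. S \<alpha> \<beta> \<subseteq> ball 0 r \<longrightarrow>
                 Marcinkiewicz_exponent r (S \<alpha> \<beta>)
                   > ereal (real n + 1) - upper_Minkowski_dim (S \<alpha> \<beta>)))"
proof -
  obtain i\<^sub>0 i\<^sub>1 :: 'm where i01: "i\<^sub>0 \<noteq> i\<^sub>1"
  proof -
    have "\<not> is_singleton (UNIV :: 'm set)" using assms(1,2) by (auto simp: is_singleton_altdef)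
    then show thesis using that by (metis UNIV_I is_singletonI' empty_not_UNIV)
  qed
  define e where "e = d - real n"
  have e: "0 < e" "e < 1" using assms by (simp_all add: e_def)
  \<comment> \<open>The upper end \<open>1 / e\<close> keeps the height exponent
    \<open>a = 1 - e * \<alpha>\<close> positive.\<close>
  define A where "A = {1<..<1 / e}"
  \<comment> \<open>The second parameter is \<beta> = n + a, and \<open>a\<close> solves
    \<open>(1 - a) / \<alpha> = e\<close>, so all members have dimension
    \<open>n + e = d\<close>.\<close>
  define P where "P = (\<lambda>\<alpha>. (\<alpha>, real n + (1 - e * \<alpha>))) ` A"
  define S where "S = (\<lambda>\<alpha> \<beta>. spiked_cube.surface \<alpha> (\<beta> - real n) i\<^sub>0 i\<^sub>1)"
  have spiked: "spiked_cube \<alpha> (1 - e * \<alpha>) i\<^sub>0 i\<^sub>1" if "\<alpha> \<in> A" for \<alpha>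
    using that e i01 by unfold_locales (auto simp: A_def field_simps)
  have S: "S \<alpha> (real n + (1 - e * \<alpha>)) = spiked_cube.surface \<alpha> (1 - e * \<alpha>) i\<^sub>0 i\<^sub>1" for \<alpha>
    by (simp add: S_def)
  \<comment> \<open>Injectivity makes the collection of surfaces uncountable, and not merely the set
    of parameters.\<close>
  have "inj_on (\<lambda>\<alpha>. spiked_cube.surface \<alpha> (1 - e * \<alpha>) i\<^sub>0 i\<^sub>1) A"
    by (intro inj_onI surface_inj[OF spiked spiked])
  moreover have "uncountable A" using e unfolding A_def by (simp add: uncountable_open_interval)
  ultimately have "uncountable ((\<lambda>\<alpha>. spiked_cube.surface \<alpha> (1 - e * \<alpha>) i\<^sub>0 i\<^sub>1) ` A)"
    using countable_image_inj_on by blast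
  then have "uncountable ((\<lambda>(\<alpha>, \<beta>). S \<alpha> \<beta>) ` P)" by (simp add: P_def image_image S)
  moreover have "\<forall>(\<alpha>, \<beta>)\<in>P. \<alpha> \<ge> 1 \<and> \<beta> \<ge> real n"
    using e by (auto simp: P_def A_def field_simps)
  moreover have "compact_topological_hypersurface n (S \<alpha> (real n + (1 - e * \<alpha>))) \<and>
      boundary_of_Jordan_domain (S \<alpha> (real n + (1 - e * \<alpha>))) \<and>
      upper_Minkowski_dim (S \<alpha> (real n + (1 - e * \<alpha>))) = ereal d \<and>
      (\<forall>r. Marcinkiewicz_exponent r (S \<alpha> (real n + (1 - e * \<alpha>)))
         > ereal (real n + 1) - upper_Minkowski_dim (S \<alpha> (real n + (1 - e * \<alpha>))))"
    if \<alpha>: "\<alpha> \<in> A" for \<alpha>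
  proof -
    interpret spiked_cube \<alpha> "1 - e * \<alpha>" i\<^sub>0 i\<^sub>1 by (rule spiked[OF \<alpha>])
    have "0 < \<alpha>" using \<alpha> by (simp add: A_def)
    then have dim: "upper_Minkowski_dim surface = ereal d"
      using upper_Minkowski_dim_surface assms(2) by (simp add: e_def)
    \<comment> \<open>Since \<open>d\<close> exceeds \<open>n\<close>, the bound to be beaten lies
      strictly below 1.\<close>
    have "ereal (real n + 1) - ereal d < 1" using assms(3) by simp
    then have "ereal (real n + 1) - ereal d < Marcinkiewicz_exponent r surface" for r
      using Marcinkiewicz_exponent_surface[of r] by (rule less_le_trans)
    then show ?thesis
      unfolding S dim
      using compact_topological_hypersurface_surface[OF assms(2)] boundary_of_Jordan_domain_surface by blast
  qed
  then have "\<forall>(\<alpha>, \<beta>)\<in>P. compact_topological_hypersurface n (S \<alpha> \<beta>) \<and>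
      boundary_of_Jordan_domain (S \<alpha> \<beta>) \<and> upper_Minkowski_dim (S \<alpha> \<beta>) = ereal d \<and>
      (\<forall>r. S \<alpha> \<beta> \<subseteq> ball 0 r \<longrightarrow>
         Marcinkiewicz_exponent r (S \<alpha> \<beta>) > ereal (real n + 1) - upper_Minkowski_dim (S \<alpha> \<beta>))"
    unfolding P_def by blast
  ultimately show ?thesis by blast
qed

end
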